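(* Let $p=\frac12$ and let $\alpha,\beta,\gamma,\delta\ge0$. Suppose that either $\max(\alpha,\gamma)=0$ and $\min(\beta,\delta)>0$, or $\min(\alpha,\gamma)>0$ and $\max(\beta,\delta)=0$. Then for all $\varepsilon\in(0,1)$ the $\varepsilon$-mixing time of the simple exclusion process with open boundaries with parameters $(\frac12,\alpha,\beta,\gamma,\delta)$ satisfies $$\lim_{N\to\infty}\frac{t^N_{\mathrm{mix}}(\varepsilon)}{N^2\log N}=\frac{4}{\pi^2}.$$
   Context: For $N\in\mathbb{N}$ let $[N]=\{1,\dots,N\}$ and $\Omega_N=\{0,1\}^N$; site $x$ is occupied by a particle in $\eta\in\Omega_N$ if $\eta(x)=1$ and empty if $\eta(x)=0$. The simple exclusion process with open boundaries with parameters $(p,\alpha,\beta,\gamma,\delta)$, $p\in[0,1]$, $\alpha,\beta,\gamma,\delta\ge0$, is the continuous-time Markov chain $(\eta_t)_{t\ge0}$ on $\Omega_N$ with generator $$\mathcal{L}f(\eta)=\sum_{x=1}^{N-1}p\,\eta(x)(1-\eta(x+1))[f(\eta^{x,x+1})-f(\eta)]+\sum_{x=2}^{N}(1-p)\,\eta(x)(1-\eta(x-1))[f(\eta^{x,x-1})-f(\eta)]$$ $$\qquad+\big(\alpha(1-\eta(1))+\gamma\eta(1)\big)[f(\eta^1)-f(\eta)]+\big(\delta(1-\eta(N))+\beta\eta(N)\big)[f(\eta^N)-f(\eta)],$$ where $\eta^{x,y}$ is $\eta$ with the values at $x,y$ exchanged and $\eta^x$ is $\eta$ with the value at $x$ flipped.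 The boundary parameters do not depend on $N$. Parameters are such that there is a unique stationary distribution $\mu$ (depending on $N$). The $\varepsilon$-mixing time is $$t^N_{\mathrm{mix}}(\varepsilon)=\inf\Big\{t\ge0:\max_{\eta\in\Omega_N}\|\mathbb{P}(\eta_t\in\cdot\mid\eta_0=\eta)-\mu\|_{\mathrm{TV}}<\varepsilon\Big\},\qquad \|\mu-\nu\|_{\mathrm{TV}}=\tfrac12\sum_{x\in\Omega_N}|\mu(x)-\nu(x)|.$$ *)

theory Defs
  imports "HOL-Probability.Probability"
begin

text \<open>Configurations on the segment \<open>[N] = {1..N}\<close> are extensional functions, so that
  \<open>configs N\<close> is a finite set with exactly \<open>2 ^ N\<close> elements.\<close>

type_synonym config = "nat \<Rightarrow> nat"

definition configs :: "nat \<Rightarrow> config set" where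
  "configs N = {1..N} \<rightarrow>\<^sub>E {0, 1}"

definition exchange :: "config \<Rightarrow> nat \<Rightarrow> nat \<Rightarrow> config" where
  "exchange \<eta> x y = \<eta>(x := \<eta> y, y := \<eta> x)"

definition flip :: "config \<Rightarrow> nat \<Rightarrow> config" where
  "flip \<eta> x = \<eta>(x := 1 - \<eta> x)"

text \<open>For \<open>N \<ge> 1\<close> and \<open>\<eta> \<in> configs N\<close>, the value at \<open>\<eta>\<close> only involves the
  values of \<open>f\<close> on \<open>configs N\<close>.\<close>

definition generator ::
  "nat \<Rightarrow> real \<Rightarrow> real \<Rightarrow> real \<Rightarrow> real \<Rightarrow> real \<Rightarrow> (config \<Rightarrow> real) \<Rightarrow> config \<Rightarrow> real" where
  "generator N p \<alpha> \<beta> \<gamma> \<delta> f \<eta> =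
     (\<Sum>x\<in>{1..<N}. p * real (\<eta> x) * (1 - real (\<eta> (x + 1))) * (f (exchange \<eta> x (x + 1)) - f \<eta>))
   + (\<Sum>x\<in>{2..N}. (1 - p) * real (\<eta> x) * (1 - real (\<eta> (x - 1))) * (f (exchange \<eta> x (x - 1)) - f \<eta>))
   + (\<alpha> * (1 - real (\<eta> 1)) + \<gamma> * real (\<eta> 1)) * (f (flip \<eta> 1) - f \<eta>)
   + (\<delta> * (1 - real (\<eta> N)) + \<beta> * real (\<eta> N)) * (f (flip \<eta> N) - f \<eta>)"

text \<open>The probability that the chain started from \<open>\<eta>\<close> is in \<open>\<xi>\<close> at time \<open>t\<close>. The state space being
  finite, the transition semigroup of the chain with generator \<open>L\<close> is \<open>exp (t L)\<close>, and this is
  \<open>exp (t L)\<close> applied to the indicator of \<open>\<xi>\<close>, evaluated at \<open>\<eta>\<close>.\<close>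

definition transition_prob ::
  "nat \<Rightarrow> real \<Rightarrow> real \<Rightarrow> real \<Rightarrow> real \<Rightarrow> real \<Rightarrow> real \<Rightarrow> config \<Rightarrow> config \<Rightarrow> real" where
  "transition_prob N p \<alpha> \<beta> \<gamma> \<delta> t \<eta> \<xi> =
     (\<Sum>k. t ^ k / fact k * (generator N p \<alpha> \<beta> \<gamma> \<delta> ^^ k) (indicator {\<xi>}) \<eta>)"

definition is_stationary ::
  "nat \<Rightarrow> real \<Rightarrow> real \<Rightarrow> real \<Rightarrow> real \<Rightarrow> real \<Rightarrow> config pmf \<Rightarrow> bool" where
  "is_stationary N p \<alpha> \<beta> \<gamma> \<delta> \<mu> \<longleftrightarrow>
     set_pmf \<mu> \<subseteq> configs N \<and>
     (\<forall>t\<ge>0. \<forall>\<xi>\<in>configs N.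
        (\<Sum>\<eta>\<in>configs N. pmf \<mu> \<eta> * transition_prob N p \<alpha> \<beta> \<gamma> \<delta> t \<eta> \<xi>) = pmf \<mu> \<xi>)"

text \<open>Meaningful when the parameters are such that the stationary distribution is unique.\<close>

definition stationary_dist ::
  "nat \<Rightarrow> real \<Rightarrow> real \<Rightarrow> real \<Rightarrow> real \<Rightarrow> real \<Rightarrow> config pmf" where
  "stationary_dist N p \<alpha> \<beta> \<gamma> \<delta> = (THE \<mu>. is_stationary N p \<alpha> \<beta> \<gamma> \<delta> \<mu>)"

definition tv_dist :: "nat \<Rightarrow> (config \<Rightarrow> real) \<Rightarrow> (config \<Rightarrow> real) \<Rightarrow> real" where
  "tv_dist N \<mu> \<nu> = 1 / 2 * (\<Sum>\<xi>\<in>configs N. \<bar>\<mu> \<xi> - \<nu> \<xi>\<bar>)"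

definition mixing_time ::
  "nat \<Rightarrow> real \<Rightarrow> real \<Rightarrow> real \<Rightarrow> real \<Rightarrow> real \<Rightarrow> real \<Rightarrow> real" where
  "mixing_time N p \<alpha> \<beta> \<gamma> \<delta> \<epsilon> =
     Inf {t. 0 \<le> t \<and>
       Max ((\<lambda>\<eta>. tv_dist N (transition_prob N p \<alpha> \<beta> \<gamma> \<delta> t \<eta>)
                        (pmf (stationary_dist N p \<alpha> \<beta> \<gamma> \<delta>))) ` configs N) < \<epsilon>}"

end

theory Submission
  imports Defs "HOL-Real_Asymp.Real_Asymp"
begin

text \<open>With only one open end the stationary distribution is the Bernoulli product measure whose
  density \<open>\<rho>\<close> is that of the open reservoir. For a set \<open>A\<close> of sites let \<open>deviation \<eta> A\<close> be the product
  of \<open>\<eta> x - \<rho>\<close> over \<open>x\<close> in \<open>A\<close>. These functions are orthogonal under the product measure, and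
  lemma \<open>duality\<close> shows that the generator acts on them as the symmetric exclusion process on the
  index set \<open>A\<close>, in which a particle at the open end kills the whole system at the total rate of that
  reservoir. Hence the expectations \<open>correlation \<eta> t A\<close> solve a closed linear system.

  The decisive inequality (\<open>killed_exclusion_prod_le\<close>, \<open>correlation_le_prod\<close>) is Liggett's
  comparison: products of supersolutions for one killed walker are supersolutions for the killed
  exclusion. One killed walker survives up to time \<open>t\<close> with probability about \<open>exp (- l * t)\<close>, where
  \<open>l\<close> is asymptotically \<open>pi\<^sup>2 / (8 * N\<^sup>2)\<close>: the eigenfunction is close to a quarter wave of a
  cosine, with frequency \<open>pi / (2 * N)\<close>, and a cosine of frequency \<open>\<theta>\<close> has the eigenvalue
  \<open>- (1 - cos \<theta>)\<close>.

  Upper bound (\<open>tv_dist_upper_bound\<close>): up to constants, expanding the density of the law at time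
  \<open>t\<close> in the orthogonal functions bounds its \<open>L\<^sup>2\<close> distance to equilibrium, squared, by the sum over
  nonempty \<open>A\<close> of products of \<open>exp (- 2 * l * t)\<close> over \<open>A\<close>, hence by
  \<open>exp (N * exp (- 2 * l * t)) - 1\<close>. This is small once \<open>t\<close> exceeds \<open>ln N / (2 * l)\<close>, which is
  asymptotically \<open>4 / pi\<^sup>2 * N\<^sup>2 * ln N\<close>. A cosine of slightly too low frequency
  (\<open>relaxing_profile\<close>) serves as the supersolution, because it is bounded below on the whole segment.

  Lower bound (\<open>tv_dist_lower_bound\<close>): from the full configuration the expected excess of the
  particle number is still of order \<open>N * exp (- l * t)\<close>, by a cosine subsolution (\<open>slow_profile\<close>).
  Liggett's comparison makes the occupations negatively correlated, so that the standard deviation is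
  at most \<open>sqrt N\<close>. Before the time \<open>ln N / (2 * l)\<close> the excess is therefore visible.

  All comparisons are instances of one maximum principle, \<open>quasimonotone_comparison\<close>.\<close>

section \<open>A comparison principle for linear systems of differential equations\<close>

text \<open>The shift \<open>v + d * exp (C * t)\<close> with \<open>C\<close> larger than all \<open>M x\<close> turns the weak
  differential inequality into a strict one. At the first time when some coordinate of the shifted
  function reaches \<open>0\<close>, the off-diagonal nonnegativity of \<open>K\<close> makes the derivative of that coordinate
  positive, which is impossible. Letting \<open>d\<close> tend to \<open>0\<close> gives the claim.\<close>

lemma quasimonotone_comparison:
  fixes v v' :: "real \<Rightarrow> 'a \<Rightarrow> real" and K :: "('a \<Rightarrow> real) \<Rightarrow> 'a \<Rightarrow> real"
  assumes fin: "finite S"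
    and deriv: "\<And>t x. t \<ge> 0 \<Longrightarrow> x \<in> S \<Longrightarrow> ((\<lambda>t. v t x) has_real_derivative v' t x) (at t)"
    and super: "\<And>t x. t \<ge> 0 \<Longrightarrow> x \<in> S \<Longrightarrow> K (v t) x \<le> v' t x"
    and quasi: "\<And>g x. x \<in> S \<Longrightarrow> g x = 0 \<Longrightarrow> (\<And>y. y \<in> S \<Longrightarrow> 0 \<le> g y) \<Longrightarrow> 0 \<le> K g x"
    and shift: "\<And>g c x. x \<in> S \<Longrightarrow> c \<ge> 0 \<Longrightarrow> K (\<lambda>y. g y + c) x \<le> K g x + c * M x"
    and init: "\<And>x. x \<in> S \<Longrightarrow> 0 \<le> v 0 x"
    and t: "t \<ge> 0" and x: "x \<in> S"
  shows "0 \<le> v t x"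
proof -
  define C where "C = 1 + (\<Sum>x\<in>S. \<bar>M x\<bar>)"
  have C: "M x < C" if "x \<in> S" for x
    using member_le_sum[OF that, of "\<lambda>x. \<bar>M x\<bar>"] fin by (auto simp: C_def)
  have pos: "0 < v t x + d * exp (C * t)" if d: "d > 0" and t: "t \<ge> 0" and x: "x \<in> S" for d t x
  proof (rule ccontr)
    define z where "z t x = v t x + d * exp (C * t)" for t x
    assume "\<not> 0 < v t x + d * exp (C * t)"
    hence neg: "z t x \<le> 0" by (simp add: z_def)
    have dz: "((\<lambda>t. z t x) has_real_derivative (v' t x + d * (C * exp (C * t)))) (at t)"
      if "t \<ge> 0" "x \<in> S" for t x
      unfolding z_def
      by (rule DERIV_add[OF deriv[OF that]]) (auto intro!: derivative_eq_intros)
    have cont: "continuous_on {0..t} (\<lambda>t. z t x)" if "x \<in> S" for x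
      using DERIV_isCont[OF dz[OF _ that]] by (intro continuous_at_imp_continuous_on ballI) auto
    define B where "B = (\<Union>y\<in>S. {s\<in>{0..t}. z s y \<le> 0})"
    have "closed {s \<in> {0..t}. z s y \<le> 0}" if "y \<in> S" for y
      by (rule continuous_on_closed_Collect_le[OF cont[OF that] continuous_on_const]) simp
    hence "closed B"
      unfolding B_def using fin by (intro closed_UN) auto
    moreover have "B \<subseteq> {0..t}" by (auto simp: B_def)
    ultimately have "compact B"
      by (metis compact_Icc compact_Int_closed inf.absorb2)
    moreover have "B \<noteq> {}" using neg x t by (auto simp: B_def)
    ultimately have "\<exists>\<tau>\<in>B. \<forall>s\<in>B. \<tau> \<le> s" by (rule compact_attains_inf)
    then obtain \<tau> where \<tau>: "\<tau> \<in> B" "\<And>s. s \<in> B \<Longrightarrow> \<tau> \<le> s" by auto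
    then obtain y where y: "y \<in> S" "z \<tau> y \<le> 0" "0 \<le> \<tau>" "\<tau> \<le> t"
      by (auto simp: B_def)
    have early: "0 < z s w" if "0 \<le> s" "s < \<tau>" "w \<in> S" for s w
      using \<tau>(2)[of s] that y(4) by (force simp: B_def)
    have "0 < z 0 y" using init[OF y(1)] d by (simp add: z_def)
    hence "\<tau> \<noteq> 0" using y(2) by auto
    hence \<tau>0: "0 < \<tau>" using y(3) by simp
    have nonneg: "0 \<le> z \<tau> w" if "w \<in> S" for w
    proof (rule tendsto_lowerbound)
      show "((\<lambda>s. z s w) \<longlongrightarrow> z \<tau> w) (at_left \<tau>)"
        using DERIV_isCont[OF dz[OF y(3) that]] unfolding isCont_def
        by (rule tendsto_within_subset) simp
      have "eventually (\<lambda>s. s \<in> {0<..<\<tau>}) (at_left \<tau>)"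
        using \<tau>0 eventually_at_left_real by blast
      thus "eventually (\<lambda>s. 0 \<le> z s w) (at_left \<tau>)"
        by eventually_elim (rule less_imp_le, rule early, use that in auto)
    qed auto
    have zy: "z \<tau> y = 0" using nonneg[OF y(1)] y(2) by simp
    have "0 \<le> K (z \<tau>) y" by (rule quasi) (use y zy nonneg in auto)
    also have "\<dots> \<le> K (v \<tau>) y + d * exp (C * \<tau>) * M y"
      using shift[OF y(1), of "d * exp (C * \<tau>)" "v \<tau>"] d by (simp add: z_def[abs_def])
    also have "\<dots> \<le> v' \<tau> y + d * exp (C * \<tau>) * M y" using super[OF y(3,1)] by simp
    also have "\<dots> < v' \<tau> y + d * exp (C * \<tau>) * C" using C[OF y(1)] d by simp
    finally have "0 < v' \<tau> y + d * (C * exp (C * \<tau>))" by (simp add: algebra_simps)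
    from DERIV_pos_inc_left[OF dz[OF y(3,1)] this] obtain e where
      e: "e > 0" "\<And>h. 0 < h \<Longrightarrow> h < e \<Longrightarrow> z (\<tau> - h) y < z \<tau> y" by blast
    define h where "h = min (e / 2) (\<tau> / 2)"
    have "0 < h" "h < e" "h < \<tau>" using e(1) \<tau>0 by (auto simp: h_def)
    thus False using e(2)[of h] early[of "\<tau> - h" y] zy y(1) by auto
  qed
  show ?thesis
  proof (rule ccontr)
    assume neg: "\<not> 0 \<le> v t x"
    define d where "d = - v t x / (2 * exp (C * t))"
    have "d > 0" using neg by (simp add: d_def divide_neg_pos not_le)
    from pos[OF this t x] show False using neg by (simp add: d_def)
  qed
qed

section \<open>The semigroup of a bounded operator on a finite set\<close>

definition op_exp :: "(('a \<Rightarrow> real) \<Rightarrow> 'a \<Rightarrow> real) \<Rightarrow> real \<Rightarrow> ('a \<Rightarrow> real) \<Rightarrow> 'a \<Rightarrow> real" where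
  "op_exp L t f x = (\<Sum>k. t ^ k / fact k * (L ^^ k) f x)"

text \<open>The bound only refers to the values on \<open>S\<close>; applied to a difference of two functions that agree
  on \<open>S\<close> it says that \<open>L\<close> restricted to \<open>S\<close> depends on values on \<open>S\<close> only.\<close>

locale bounded_operator =
  fixes L :: "('a \<Rightarrow> real) \<Rightarrow> 'a \<Rightarrow> real" and S :: "'a set" and M :: real
  assumes fin: "finite S"
    and linear: "L (\<lambda>x. c * f x + g x) = (\<lambda>x. c * L f x + L g x)"
    and bound: "x \<in> S \<Longrightarrow> (\<And>y. y \<in> S \<Longrightarrow> \<bar>f y\<bar> \<le> b) \<Longrightarrow> \<bar>L f x\<bar> \<le> M * b"
begin

lemma zero: "L (\<lambda>x. 0) = (\<lambda>x. 0)"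
  using linear[of "-1" "\<lambda>x. 0" "\<lambda>x. 0"] by simp

lemma sum: "finite I \<Longrightarrow> L (\<lambda>x. \<Sum>i\<in>I. c i * f i x) = (\<lambda>x. \<Sum>i\<in>I. c i * L (f i) x)"
  by (induction rule: finite_induct) (simp_all add: zero linear)

lemma cong:
  assumes "\<And>y. y \<in> S \<Longrightarrow> f y = g y" "x \<in> S"
  shows "L f x = L g x"
proof -
  have "\<bar>L (\<lambda>x. (-1) * f x + g x) x\<bar> \<le> M * 0"
    by (rule bound) (use assms in auto)
  thus ?thesis unfolding linear by simp
qed

lemma power_sum:
  "finite I \<Longrightarrow> (L ^^ k) (\<lambda>x. \<Sum>i\<in>I. c i * f i x) = (\<lambda>x. \<Sum>i\<in>I. c i * (L ^^ k) (f i) x)"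
  by (induction k) (simp_all add: sum)

lemma power_cong:
  assumes "\<And>y. y \<in> S \<Longrightarrow> f y = g y" "x \<in> S"
  shows "(L ^^ k) f x = (L ^^ k) g x"
  using assms(2) by (induction k arbitrary: x) (auto simp: assms(1) intro!: cong)

lemma power_bound:
  assumes "\<And>y. y \<in> S \<Longrightarrow> \<bar>f y\<bar> \<le> b" "x \<in> S"
  shows "\<bar>(L ^^ k) f x\<bar> \<le> M ^ k * b"
  using assms(2)
proof (induction k arbitrary: x)
  case 0
  thus ?case using assms(1) by simp
next
  case (Suc k)
  show ?case using bound[OF Suc.prems Suc.IH] by (simp add: mult.assoc)
qed

lemma summable_op_exp:
  assumes "x \<in> S"
  shows "summable (\<lambda>k. t ^ k / fact k * (L ^^ k) f x)"
proof -
  define b where "b = (\<Sum>y\<in>S. \<bar>f y\<bar>)"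
  have b: "\<bar>f y\<bar> \<le> b" if "y \<in> S" for y
    unfolding b_def using member_le_sum[OF that, of "\<lambda>y. \<bar>f y\<bar>"] fin by auto
  have "summable (\<lambda>k. (\<bar>t\<bar> * M) ^ k /\<^sub>R fact k)" by (rule summable_exp_generic)
  hence "summable (\<lambda>k. b * ((\<bar>t\<bar> * M) ^ k /\<^sub>R fact k))" by (rule summable_mult)
  thus ?thesis
  proof (rule summable_comparison_test')
    fix k :: nat
    have "norm (t ^ k / fact k * (L ^^ k) f x) = \<bar>t\<bar> ^ k / fact k * \<bar>(L ^^ k) f x\<bar>"
      by (simp add: abs_mult power_abs)
    also have "\<dots> \<le> \<bar>t\<bar> ^ k / fact k * (M ^ k * b)"
      by (intro mult_left_mono power_bound b assms) auto
    finally show "norm (t ^ k / fact k * (L ^^ k) f x) \<le> b * ((\<bar>t\<bar> * M) ^ k /\<^sub>R fact k)"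
      by (simp add: field_simps power_mult_distrib)
  qed
qed

lemma op_exp_sum:
  assumes "finite I" "x \<in> S"
  shows "op_exp L t (\<lambda>x. \<Sum>i\<in>I. c i * f i x) x = (\<Sum>i\<in>I. c i * op_exp L t (f i) x)"
proof -
  have "op_exp L t (\<lambda>x. \<Sum>i\<in>I. c i * f i x) x =
          (\<Sum>k. \<Sum>i\<in>I. c i * (t ^ k / fact k * (L ^^ k) (f i) x))"
    using assms(1) by (simp add: op_exp_def power_sum sum_distrib_left mult_ac)
  also have "\<dots> = (\<Sum>i\<in>I. \<Sum>k. c i * (t ^ k / fact k * (L ^^ k) (f i) x))"
    by (rule suminf_sum) (intro summable_mult summable_op_exp assms)
  also have "\<dots> = (\<Sum>i\<in>I. c i * op_exp L t (f i) x)"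
    unfolding op_exp_def
    by (intro sum.cong refl suminf_mult summable_op_exp assms)
  finally show ?thesis .
qed

lemma op_exp_cong:
  "(\<And>y. y \<in> S \<Longrightarrow> f y = g y) \<Longrightarrow> x \<in> S \<Longrightarrow> op_exp L t f x = op_exp L t g x"
  unfolding op_exp_def using power_cong by metis

lemma op_exp_0: "op_exp L 0 f x = f x"
  unfolding op_exp_def by (subst suminf_finite[of "{0}"]) auto

lemma op_exp_deriv:
  assumes "x \<in> S"
  shows "((\<lambda>t. op_exp L t f x) has_real_derivative op_exp L t (L f) x) (at t)"
proof -
  define c where "c k = (L ^^ k) f x / fact k" for k
  have s: "summable (\<lambda>k. c k * y ^ k)" for y
    using summable_op_exp[OF assms, of y f] by (simp add: c_def mult.commute)
  have "((\<lambda>t. \<Sum>k. c k * t ^ k) has_real_derivative (\<Sum>k. diffs c k * t ^ k)) (at t)"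
    by (rule termdiffs_strong_converges_everywhere) (rule s)
  moreover have "(\<Sum>k. c k * t ^ k) = op_exp L t f x" for t
    by (simp add: c_def op_exp_def mult.commute)
  moreover have "(\<Sum>k. diffs c k * t ^ k) = op_exp L t (L f) x"
    unfolding op_exp_def diffs_def c_def
    by (intro suminf_cong) (simp add: funpow_Suc_right del: funpow.simps of_nat_Suc)
  ultimately show ?thesis by simp
qed

lemma op_exp_stationary:
  assumes "\<And>y. y \<in> S \<Longrightarrow> L f y = 0" "x \<in> S"
  shows "op_exp L t f x = f x"
proof -
  have "(L ^^ Suc k) f x = 0" for k
    using power_cong[of "L f" "\<lambda>x. 0" x k] assms power_sum[of "{}" k "\<lambda>_. 0" "\<lambda>_ _. 0"]
    by (simp add: funpow_Suc_right del: funpow.simps)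
  hence "(L ^^ k) f x = 0" if "k \<noteq> 0" for k using that by (cases k) auto
  thus ?thesis unfolding op_exp_def by (subst suminf_finite[of "{0}"]) auto
qed

text \<open>The weights \<open>y \<mapsto> op_exp L t (indicator {y}) x\<close> solve the forward equation, whose
  off-diagonal coefficients are those of \<open>L\<close>.\<close>

lemma op_exp_indicator_nonneg:
  assumes off_diagonal: "\<And>y z. y \<in> S \<Longrightarrow> z \<in> S \<Longrightarrow> y \<noteq> z \<Longrightarrow> 0 \<le> L (indicator {y}) z"
    and "t \<ge> 0" "x \<in> S" "y \<in> S"
  shows "0 \<le> op_exp L t (indicator {y}) x"
proof -
  have L_eq: "L f z = (\<Sum>w\<in>S. f w * L (indicator {w}) z)" if "z \<in> S" for f z
  proof -
    have "L f z = L (\<lambda>z. \<Sum>w\<in>S. f w * indicator {w} z) z"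
      by (rule cong) (use that fin in \<open>auto simp: indicator_def if_distrib cong: if_cong\<close>)
    also have "\<dots> = (\<Sum>w\<in>S. f w * L (indicator {w}) z)"
      by (simp only: sum[OF fin, of f "\<lambda>w. indicator {w}"])
    finally show ?thesis .
  qed
  define a where "a y z = L (indicator {y}) z" for y z
  show ?thesis
  proof (rule quasimonotone_comparison[where v = "\<lambda>t y. op_exp L t (indicator {y}) x"
        and v' = "\<lambda>t y. op_exp L t (L (indicator {y})) x"
        and K = "\<lambda>g y. \<Sum>z\<in>S. a y z * g z" and M = "\<lambda>y. \<Sum>z\<in>S. a y z" and S = S])
    fix t y assume y: "y \<in> S"
    have "op_exp L t (L (indicator {y})) x =
            op_exp L t (\<lambda>z. \<Sum>w\<in>S. a y w * indicator {w} z) x"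
      by (rule op_exp_cong)
        (use fin \<open>x \<in> S\<close> in \<open>auto simp: a_def indicator_def if_distrib cong: if_cong\<close>)
    also have "\<dots> = (\<Sum>w\<in>S. a y w * op_exp L t (indicator {w}) x)"
      using fin \<open>x \<in> S\<close> by (rule op_exp_sum)
    finally show "(\<Sum>z\<in>S. a y z * op_exp L t (indicator {z}) x)
        \<le> op_exp L t (L (indicator {y})) x" by simp
  next
    fix g :: "'a \<Rightarrow> real" and y assume "y \<in> S" "g y = 0" "\<And>z. z \<in> S \<Longrightarrow> 0 \<le> g z"
    thus "0 \<le> (\<Sum>z\<in>S. a y z * g z)"
      by (intro sum_nonneg) (metis a_def mult_nonneg_nonneg mult_zero_right off_diagonal order_refl)
  qed (use assms fin in \<open>auto simp: op_exp_0 sum.distrib sum_distrib_left algebra_simps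
        intro!: op_exp_deriv\<close>)
qed

end

section \<open>Exclusion and random walk with killing at the end points\<close>

definition killed_walk :: "nat \<Rightarrow> real \<Rightarrow> real \<Rightarrow> (nat \<Rightarrow> real) \<Rightarrow> nat \<Rightarrow> real" where
  "killed_walk N \<kappa>\<^sub>l \<kappa>\<^sub>r w x =
     (\<Sum>y\<in>{1..<N}. 1 / 2 * (w (Transposition.transpose y (Suc y) x) - w x))
       - (\<kappa>\<^sub>l * of_bool (x = 1) + \<kappa>\<^sub>r * of_bool (x = N)) * w x"

text \<open>The generator of exclusion on the set \<open>A\<close> of occupied sites in which every particle at an
  end point kills the whole system, not just itself.\<close>

definition killed_exclusion :: "nat \<Rightarrow> real \<Rightarrow> real \<Rightarrow> (nat set \<Rightarrow> real) \<Rightarrow> nat set \<Rightarrow> real" where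
  "killed_exclusion N \<kappa>\<^sub>l \<kappa>\<^sub>r g A =
     (\<Sum>y\<in>{1..<N}. 1 / 2 * (g (Transposition.transpose y (Suc y) ` A) - g A))
       - (\<kappa>\<^sub>l * of_bool (1 \<in> A) + \<kappa>\<^sub>r * of_bool (N \<in> A)) * g A"

lemma killed_exclusion_singleton:
  "killed_exclusion N \<kappa>\<^sub>l \<kappa>\<^sub>r g {x} = killed_walk N \<kappa>\<^sub>l \<kappa>\<^sub>r (\<lambda>x. g {x}) x"
  by (simp add: killed_exclusion_def killed_walk_def eq_commute)

lemma killed_exclusion_diff:
  "killed_exclusion N \<kappa>\<^sub>l \<kappa>\<^sub>r (\<lambda>A. g A - h A) A =
     killed_exclusion N \<kappa>\<^sub>l \<kappa>\<^sub>r g A - killed_exclusion N \<kappa>\<^sub>l \<kappa>\<^sub>r h A"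
  by (simp add: killed_exclusion_def sum_subtractf [symmetric] algebra_simps)
     (simp add: sum_subtractf sum.distrib algebra_simps)

lemma killed_exclusion_mult:
  "killed_exclusion N \<kappa>\<^sub>l \<kappa>\<^sub>r (\<lambda>A. c * g A) A = c * killed_exclusion N \<kappa>\<^sub>l \<kappa>\<^sub>r g A"
  by (simp add: killed_exclusion_def algebra_simps sum_distrib_left)

lemma killed_walk_diff:
  "killed_walk N \<kappa>\<^sub>l \<kappa>\<^sub>r (\<lambda>x. v x - w x) x = killed_walk N \<kappa>\<^sub>l \<kappa>\<^sub>r v x - killed_walk N \<kappa>\<^sub>l \<kappa>\<^sub>r w x"
  by (simp add: killed_walk_def sum_subtractf [symmetric] algebra_simps)
     (simp add: sum_subtractf sum.distrib algebra_simps)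

lemma killed_walk_mult:
  "killed_walk N \<kappa>\<^sub>l \<kappa>\<^sub>r (\<lambda>x. c * w x) x = c * killed_walk N \<kappa>\<^sub>l \<kappa>\<^sub>r w x"
  by (simp add: killed_walk_def algebra_simps sum_distrib_left)

lemma killed_walk_explicit:
  assumes "x \<in> {1..N}"
  shows "killed_walk N \<kappa>\<^sub>l \<kappa>\<^sub>r w x =
           of_bool (x < N) * (w (x + 1) - w x) / 2 + of_bool (1 < x) * (w (x - 1) - w x) / 2
             - (\<kappa>\<^sub>l * of_bool (x = 1) + \<kappa>\<^sub>r * of_bool (x = N)) * w x"
proof -
  have "1 / 2 * (w (Transposition.transpose y (Suc y) x) - w x) =
          of_bool (y = x) * ((w (x + 1) - w x) / 2) + of_bool (y = x - 1) * ((w (x - 1) - w x) / 2)"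
    if "y \<in> {1..<N}" for y
    using that assms by (auto simp: Transposition.transpose_def)
  hence "(\<Sum>y\<in>{1..<N}. 1 / 2 * (w (Transposition.transpose y (Suc y) x) - w x)) =
           (\<Sum>y\<in>{1..<N}. of_bool (y = x) * ((w (x + 1) - w x) / 2)
              + of_bool (y = x - 1) * ((w (x - 1) - w x) / 2))"
    by (intro sum.cong refl)
  also have "\<dots> = (\<Sum>y\<in>{1..<N}. of_bool (y = x)) * ((w (x + 1) - w x) / 2)
             + (\<Sum>y\<in>{1..<N}. of_bool (y = x - 1)) * ((w (x - 1) - w x) / 2)"
    by (simp only: sum.distrib sum_distrib_right)
  also have "(\<Sum>y\<in>{1..<N}. of_bool (y = x)) = (of_bool (x < N) :: real)"
    using assms by (simp add: of_bool_def)
  also have "(\<Sum>y\<in>{1..<N}. of_bool (y = x - 1)) = (of_bool (1 < x) :: real)"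
    using assms by (auto simp add: of_bool_def)
  finally show ?thesis by (simp add: killed_walk_def)
qed

lemma killed_walk_reflect:
  assumes "x \<in> {1..N}"
  shows "killed_walk N \<kappa>\<^sub>l \<kappa>\<^sub>r (\<lambda>x. w (N + 1 - x)) x = killed_walk N \<kappa>\<^sub>r \<kappa>\<^sub>l w (N + 1 - x)"
proof -
  have r: "N + 1 - x \<in> {1..N}" using assms by auto
  have "N + 1 - (x + 1) = (N + 1 - x) - 1" by simp
  moreover have "N + 1 - (x - 1) = (N + 1 - x) + 1" if "1 < x" using that assms by auto
  moreover have "(N + 1 - x < N) = (1 < x)" "(1 < N + 1 - x) = (x < N)"
    "(N + 1 - x = 1) = (x = N)" "(N + 1 - x = N) = (x = 1)"
    using assms by auto
  ultimately show ?thesis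
    unfolding killed_walk_explicit[OF assms] killed_walk_explicit[OF r] by auto
qed

text \<open>For a neighbouring pair \<open>a, b\<close> the two sides agree unless both sites lie in \<open>A\<close>: exclusion
  then forbids both moves, and independent walkers gain \<open>(w a - w b)\<^sup>2\<close> times the product over the other sites.\<close>

lemma transpose_prod_le:
  fixes w :: "nat \<Rightarrow> real"
  assumes "finite A" "a \<noteq> b" and nonneg: "\<And>x. x \<in> A \<Longrightarrow> 0 \<le> w x"
  shows "prod w (Transposition.transpose a b ` A) - prod w A \<le>
           (\<Sum>x\<in>A. (w (Transposition.transpose a b x) - w x) * prod w (A - {x}))" (is "_ \<le> ?R")
proof -
  have R: "?R = (\<Sum>x\<in>A \<inter> {a, b}. (w (Transposition.transpose a b x) - w x) * prod w (A - {x}))"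
    using assms(1) by (intro sum.mono_neutral_right) (auto simp: Transposition.transpose_def)
  have one_site: "prod w (Transposition.transpose c d ` A) - prod w A = (w d - w c) * prod w (A - {c})"
    if "c \<in> A" "d \<notin> A" for c d
  proof -
    have "Transposition.transpose c d ` A = insert d (A - {c})"
      using that by (auto simp: in_transpose_image_iff) (auto simp: Transposition.transpose_def split: if_splits)
    thus ?thesis using that assms(1) by (simp add: prod.remove[of A c] algebra_simps)
  qed
  consider "a \<in> A" "b \<in> A" | "a \<in> A" "b \<notin> A" | "a \<notin> A" "b \<in> A" | "a \<notin> A" "b \<notin> A" by blast
  thus ?thesis
  proof cases
    case 1
    define r where "r = prod w (A - {a, b})"
    have "A - {a} - {b} = A - {a, b}" "A - {b} - {a} = A - {a, b}" by auto
    moreover have "prod w (A - {a}) = w b * prod w (A - {a} - {b})"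
      "prod w (A - {b}) = w a * prod w (A - {b} - {a})"
      using 1 assms(1,2) by (auto intro!: prod.remove)
    ultimately have r: "prod w (A - {a}) = w b * r" "prod w (A - {b}) = w a * r"
      by (simp_all only: r_def)
    have "A \<inter> {a, b} = {a, b}" using 1 by auto
    hence "?R = (w b - w a) * (w b * r) + (w a - w b) * (w a * r)"
      unfolding R using assms(2) by (simp add: r)
    also have "\<dots> = (w a - w b)\<^sup>2 * r" by (simp add: power2_eq_square algebra_simps)
    finally have "?R = (w a - w b)\<^sup>2 * r" .
    moreover have "0 \<le> r" unfolding r_def using nonneg by (intro prod_nonneg) auto
    moreover have "Transposition.transpose a b ` A = A"
      using 1 by (intro transpose_image_eq) auto
    ultimately show ?thesis by simp
  next
    case 2
    moreover have "A \<inter> {a, b} = {a}" using 2 by auto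
    ultimately show ?thesis unfolding R by (simp add: one_site)
  next
    case 3
    moreover have "A \<inter> {a, b} = {b}" using 3 by auto
    ultimately show ?thesis
      unfolding R by (simp add: one_site transpose_commute[of a b])
  next
    case 4
    moreover have "A \<inter> {a, b} = {}" using 4 by auto
    moreover have "Transposition.transpose a b ` A = A"
      using 4 by (intro transpose_image_eq) auto
    ultimately show ?thesis unfolding R by simp
  qed
qed

text \<open>Liggett's comparison of exclusion with independent walkers, at the level of generators: the
  right hand side is the generator of independent walkers applied to the product \<open>prod w\<close>.\<close>

lemma killed_exclusion_prod_le:
  assumes A: "A \<subseteq> {1..N}" and nonneg: "\<And>x. x \<in> A \<Longrightarrow> 0 \<le> w x"
  shows "killed_exclusion N \<kappa>\<^sub>l \<kappa>\<^sub>r (prod w) A \<le>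
           (\<Sum>x\<in>A. killed_walk N \<kappa>\<^sub>l \<kappa>\<^sub>r w x * prod w (A - {x}))"
proof -
  have fin: "finite A" using A finite_subset by blast
  have kill: "(\<kappa>\<^sub>l * of_bool (1 \<in> A) + \<kappa>\<^sub>r * of_bool (N \<in> A)) * prod w A =
      (\<Sum>x\<in>A. (\<kappa>\<^sub>l * of_bool (x = 1) + \<kappa>\<^sub>r * of_bool (x = N)) * w x * prod w (A - {x}))"
  proof -
    have "(\<Sum>x\<in>A. (\<kappa>\<^sub>l * of_bool (x = 1) + \<kappa>\<^sub>r * of_bool (x = N)) * w x * prod w (A - {x})) =
        (\<Sum>x\<in>A. (\<kappa>\<^sub>l * of_bool (x = 1) + \<kappa>\<^sub>r * of_bool (x = N)) * prod w A)"
      by (intro sum.cong refl) (simp add: prod.remove[OF fin, of _ w] mult.assoc)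
    also have "\<dots> = (\<kappa>\<^sub>l * (\<Sum>x\<in>A. of_bool (x = 1)) + \<kappa>\<^sub>r * (\<Sum>x\<in>A. of_bool (x = N))) * prod w A"
      by (simp only: sum_distrib_right sum_distrib_left sum.distrib distrib_right)
    finally show ?thesis using fin by (simp add: of_bool_def)
  qed
  have "(\<Sum>y\<in>{1..<N}. 1 / 2 * (prod w (Transposition.transpose y (Suc y) ` A) - prod w A)) \<le>
      (\<Sum>y\<in>{1..<N}. 1 / 2 * (\<Sum>x\<in>A. (w (Transposition.transpose y (Suc y) x) - w x) * prod w (A - {x})))"
    by (intro sum_mono mult_left_mono transpose_prod_le fin nonneg) auto
  also have "\<dots> = (\<Sum>x\<in>A. (\<Sum>y\<in>{1..<N}. 1 / 2 * (w (Transposition.transpose y (Suc y) x) - w x)) * prod w (A - {x}))"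
    unfolding sum_distrib_left sum_distrib_right by (subst sum.swap) (simp add: mult.assoc)
  finally show ?thesis
    unfolding killed_exclusion_def kill killed_walk_def left_diff_distrib sum_subtractf by simp
qed

lemma transpose_image_subset:
  "A \<subseteq> {1..N} \<Longrightarrow> y \<in> {1..<N} \<Longrightarrow> Transposition.transpose y (Suc y) ` A \<subseteq> {1..N}"
  by (auto simp: Transposition.transpose_def)

lemma killed_exclusion_comparison:
  fixes v v' :: "real \<Rightarrow> nat set \<Rightarrow> real"
  assumes "0 \<le> \<kappa>\<^sub>l" "0 \<le> \<kappa>\<^sub>r"
    and "\<And>t A. t \<ge> 0 \<Longrightarrow> A \<subseteq> {1..N} \<Longrightarrow> ((\<lambda>t. v t A) has_real_derivative v' t A) (at t)"
    and "\<And>t A. t \<ge> 0 \<Longrightarrow> A \<subseteq> {1..N} \<Longrightarrow> killed_exclusion N \<kappa>\<^sub>l \<kappa>\<^sub>r (v t) A \<le> v' t A"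
    and "\<And>A. A \<subseteq> {1..N} \<Longrightarrow> 0 \<le> v 0 A"
    and "t \<ge> 0" "A \<subseteq> {1..N}"
  shows "0 \<le> v t A"
proof (rule quasimonotone_comparison[where v = v and S = "Pow {1..N}" and M = "\<lambda>_. 0"
      and K = "killed_exclusion N \<kappa>\<^sub>l \<kappa>\<^sub>r" and v' = v'])
  fix g :: "nat set \<Rightarrow> real" and A
  assume "A \<in> Pow {1..N}" "g A = 0" and "\<And>B. B \<in> Pow {1..N} \<Longrightarrow> 0 \<le> g B"
  thus "0 \<le> killed_exclusion N \<kappa>\<^sub>l \<kappa>\<^sub>r g A"
    unfolding killed_exclusion_def
    using transpose_image_subset[of A N] by (auto intro!: sum_nonneg)
next
  fix g :: "nat set \<Rightarrow> real" and c :: real and A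
  assume "0 \<le> c"
  thus "killed_exclusion N \<kappa>\<^sub>l \<kappa>\<^sub>r (\<lambda>A. g A + c) A \<le> killed_exclusion N \<kappa>\<^sub>l \<kappa>\<^sub>r g A + c * 0"
    using assms(1,2) by (simp add: killed_exclusion_def algebra_simps)
qed (use assms in auto)

lemma killed_walk_comparison:
  fixes v v' :: "real \<Rightarrow> nat \<Rightarrow> real"
  assumes "0 \<le> \<kappa>\<^sub>l" "0 \<le> \<kappa>\<^sub>r"
    and "\<And>t x. t \<ge> 0 \<Longrightarrow> x \<in> {1..N} \<Longrightarrow> ((\<lambda>t. v t x) has_real_derivative v' t x) (at t)"
    and "\<And>t x. t \<ge> 0 \<Longrightarrow> x \<in> {1..N} \<Longrightarrow> killed_walk N \<kappa>\<^sub>l \<kappa>\<^sub>r (v t) x \<le> v' t x"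
    and "\<And>x. x \<in> {1..N} \<Longrightarrow> 0 \<le> v 0 x"
    and "t \<ge> 0" "x \<in> {1..N}"
  shows "0 \<le> v t x"
proof (rule quasimonotone_comparison[where v = v and S = "{1..N}" and M = "\<lambda>_. 0"
      and K = "killed_walk N \<kappa>\<^sub>l \<kappa>\<^sub>r" and v' = v'])
  fix g :: "nat \<Rightarrow> real" and x
  assume x: "x \<in> {1..N}" and g: "g x = 0" "\<And>y. y \<in> {1..N} \<Longrightarrow> 0 \<le> g y"
  have "0 \<le> g (Transposition.transpose y (Suc y) x)" if "y \<in> {1..<N}" for y
    using transpose_image_subset[of "{x}" N y] that x g(2) by auto
  thus "0 \<le> killed_walk N \<kappa>\<^sub>l \<kappa>\<^sub>r g x"
    unfolding killed_walk_def g(1) by (auto intro!: sum_nonneg)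
next
  fix g :: "nat \<Rightarrow> real" and c :: real and x
  assume "0 \<le> c"
  thus "killed_walk N \<kappa>\<^sub>l \<kappa>\<^sub>r (\<lambda>x. g x + c) x \<le> killed_walk N \<kappa>\<^sub>l \<kappa>\<^sub>r g x + c * 0"
    using assms(1,2) by (simp add: killed_walk_def algebra_simps)
qed (use assms in auto)

section \<open>Duality for reservoirs of equal density\<close>

lemma finite_configs [simp]: "finite (configs N)"
  unfolding configs_def by (intro finite_PiE) auto

lemma configs_values: "\<eta> \<in> configs N \<Longrightarrow> x \<in> {1..N} \<Longrightarrow> \<eta> x = 0 \<or> \<eta> x = 1"
  unfolding configs_def by (drule (1) PiE_mem) auto

lemma exchange_in_configs:
  assumes "\<eta> \<in> configs N" "x \<in> {1..N}" "y \<in> {1..N}"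
  shows "exchange \<eta> x y \<in> configs N"
  using assms unfolding configs_def exchange_def by (auto simp: PiE_iff extensional_def)

lemma flip_in_configs: "\<eta> \<in> configs N \<Longrightarrow> x \<in> {1..N} \<Longrightarrow> flip \<eta> x \<in> configs N"
  unfolding configs_def flip_def by (auto simp: PiE_iff extensional_def)

lemma exchange_eq_transpose: "exchange \<eta> x y z = \<eta> (Transposition.transpose x y z)"
  by (auto simp: exchange_def Transposition.transpose_def)

text \<open>At \<open>p = 1 / 2\<close> the two jump rates across a bond add up to an exchange of the contents of the
  bond at rate \<open>1 / 2\<close>; exchanging equal contents has no effect.\<close>

lemma symmetric_generator:
  assumes \<eta>: "\<eta> \<in> configs N"
  shows "generator N (1 / 2) \<alpha> \<beta> \<gamma> \<delta> f \<eta> =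
     (\<Sum>y\<in>{1..<N}. 1 / 2 * (f (exchange \<eta> y (Suc y)) - f \<eta>))
   + (\<alpha> * (1 - real (\<eta> 1)) + \<gamma> * real (\<eta> 1)) * (f (flip \<eta> 1) - f \<eta>)
   + (\<delta> * (1 - real (\<eta> N)) + \<beta> * real (\<eta> N)) * (f (flip \<eta> N) - f \<eta>)"
proof -
  have "{2..N} = Suc ` {1..<N}"
    by (simp add: image_Suc_atLeastLessThan atLeastLessThanSuc_atLeastAtMost)
  hence "(\<Sum>x\<in>{2..N}. (1 - 1 / 2) * real (\<eta> x) * (1 - real (\<eta> (x - 1))) * (f (exchange \<eta> x (x - 1)) - f \<eta>))
     = (\<Sum>y\<in>{1..<N}. 1 / 2 * real (\<eta> (Suc y)) * (1 - real (\<eta> y)) * (f (exchange \<eta> (Suc y) y) - f \<eta>))"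
    by (simp only: sum.reindex[OF inj_on_subset[OF inj_Suc subset_UNIV]] o_def diff_Suc_1) simp
  moreover have "1 / 2 * real (\<eta> y) * (1 - real (\<eta> (y + 1))) * (f (exchange \<eta> y (y + 1)) - f \<eta>)
      + 1 / 2 * real (\<eta> (Suc y)) * (1 - real (\<eta> y)) * (f (exchange \<eta> (Suc y) y) - f \<eta>)
      = 1 / 2 * (f (exchange \<eta> y (Suc y)) - f \<eta>)" if "y \<in> {1..<N}" for y
  proof -
    have "exchange \<eta> (Suc y) y = exchange \<eta> y (Suc y)" by (auto simp: exchange_def)
    moreover have "exchange \<eta> y (Suc y) = \<eta>" if "\<eta> y = \<eta> (Suc y)"
      using that by (auto simp: exchange_def)
    moreover have "\<eta> y = 0 \<or> \<eta> y = 1" "\<eta> (Suc y) = 0 \<or> \<eta> (Suc y) = 1"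
      using that configs_values[OF \<eta>] by auto
    ultimately show ?thesis by auto
  qed
  hence "(\<Sum>y\<in>{1..<N}. 1 / 2 * real (\<eta> y) * (1 - real (\<eta> (y + 1))) * (f (exchange \<eta> y (y + 1)) - f \<eta>))
      + (\<Sum>y\<in>{1..<N}. 1 / 2 * real (\<eta> (Suc y)) * (1 - real (\<eta> y)) * (f (exchange \<eta> (Suc y) y) - f \<eta>))
      = (\<Sum>y\<in>{1..<N}. 1 / 2 * (f (exchange \<eta> y (Suc y)) - f \<eta>))"
    unfolding sum.distrib [symmetric] by (intro sum.cong refl)
  ultimately show ?thesis unfolding generator_def by argo
qed

locale equal_reservoirs =
  fixes N :: nat and \<alpha> \<beta> \<gamma> \<delta> \<rho> :: real
  assumes N: "1 \<le> N"
    and rates: "0 \<le> \<alpha>" "0 \<le> \<beta>" "0 \<le> \<gamma>" "0 \<le> \<delta>"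
    and density: "\<alpha> = \<rho> * (\<alpha> + \<gamma>)" "\<delta> = \<rho> * (\<beta> + \<delta>)"
    and \<rho>: "0 < \<rho>" "\<rho> < 1"
begin

abbreviation "L \<equiv> generator N (1 / 2) \<alpha> \<beta> \<gamma> \<delta>"
abbreviation "walk \<equiv> killed_walk N (\<alpha> + \<gamma>) (\<beta> + \<delta>)"
abbreviation "dual \<equiv> killed_exclusion N (\<alpha> + \<gamma>) (\<beta> + \<delta>)"

lemma ends: "1 \<in> {1..N}" "N \<in> {1..N}"
  using N by auto

sublocale bounded_operator L "configs N" "real N + 2 * (\<alpha> + \<beta> + \<gamma> + \<delta>)"
proof
  fix c f g
  have "r * ((c * f \<xi> + g \<xi>) - (c * f \<eta> + g \<eta>)) = c * (r * (f \<xi> - f \<eta>)) + r * (g \<xi> - g \<eta>)"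
    for \<xi> \<eta> :: config and r :: real
    by (simp add: algebra_simps)
  thus "L (\<lambda>x. c * f x + g x) = (\<lambda>x. c * L f x + L g x)"
    unfolding generator_def
    by (simp only: sum.distrib sum_distrib_left [symmetric]) (simp add: algebra_simps)
next
  fix \<eta> f b assume \<eta>: "\<eta> \<in> configs N" and b: "\<And>\<xi>. \<xi> \<in> configs N \<Longrightarrow> \<bar>f \<xi>\<bar> \<le> (b :: real)"
  have diff: "\<bar>f \<xi> - f \<eta>\<bar> \<le> 2 * b" if "\<xi> \<in> configs N" for \<xi>
    using b[OF \<eta>] b[OF that] by linarith
  have b0: "0 \<le> b" using b[OF \<eta>] by linarith
  have "\<bar>\<Sum>y\<in>{1..<N}. 1 / 2 * (f (exchange \<eta> y (Suc y)) - f \<eta>)\<bar> \<le> (\<Sum>y\<in>{1..<N}. b)"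
  proof (rule order_trans[OF sum_abs], rule sum_mono)
    fix y assume "y \<in> {1..<N}"
    hence "exchange \<eta> y (Suc y) \<in> configs N" using \<eta> by (intro exchange_in_configs) auto
    from diff[OF this] show "\<bar>1 / 2 * (f (exchange \<eta> y (Suc y)) - f \<eta>)\<bar> \<le> b" by simp
  qed
  also have "\<dots> \<le> real N * b" using b0 by (simp add: mult_right_mono)
  finally have bulk: "\<bar>\<Sum>y\<in>{1..<N}. 1 / 2 * (f (exchange \<eta> y (Suc y)) - f \<eta>)\<bar> \<le> real N * b" .
  have boundary: "\<bar>(a * (1 - real (\<eta> x)) + g * real (\<eta> x)) * (f (flip \<eta> x) - f \<eta>)\<bar> \<le> (a + g) * (2 * b)"
    if "x \<in> {1..N}" "0 \<le> a" "0 \<le> g" for x a g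
    unfolding abs_mult using configs_values[OF \<eta> that(1)] that
    by (intro mult_mono diff flip_in_configs \<eta>) auto
  show "\<bar>L f \<eta>\<bar> \<le> (real N + 2 * (\<alpha> + \<beta> + \<gamma> + \<delta>)) * b"
    unfolding symmetric_generator[OF \<eta>]
    using bulk boundary[OF ends(1) rates(1,3)] boundary[OF ends(2) rates(4,2)]
    by (simp add: algebra_simps)
qed (rule finite_configs)

lemma transition_prob_eq:
  "transition_prob N (1 / 2) \<alpha> \<beta> \<gamma> \<delta> t \<eta> \<xi> = op_exp L t (indicator {\<xi>}) \<eta>"
  by (simp add: transition_prob_def op_exp_def)

definition deviation :: "config \<Rightarrow> nat set \<Rightarrow> real" where
  "deviation \<eta> A = (\<Prod>x\<in>A. real (\<eta> x) - \<rho>)"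

lemma deviation_exchange:
  "deviation (exchange \<eta> x y) A = deviation \<eta> (Transposition.transpose x y ` A)"
  unfolding deviation_def by (subst prod.reindex) (auto simp: exchange_eq_transpose)

text \<open>The flip rates at an end point relax the occupation to its mean \<open>\<rho>\<close> at rate \<open>a + g\<close>.\<close>

lemma deviation_flip:
  assumes "\<eta> \<in> configs N" "b \<in> {1..N}" "A \<subseteq> {1..N}" "a = \<rho> * (a + g)"
  shows "(a * (1 - real (\<eta> b)) + g * real (\<eta> b)) * (deviation (flip \<eta> b) A - deviation \<eta> A) =
           - (a + g) * of_bool (b \<in> A) * deviation \<eta> A"
proof (cases "b \<in> A")
  case True
  have fin: "finite A" using assms(3) finite_subset by blast
  have "deviation (flip \<eta> b) A = (real (flip \<eta> b b) - \<rho>) * deviation (flip \<eta> b) (A - {b})"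
    "deviation \<eta> A = (real (\<eta> b) - \<rho>) * deviation \<eta> (A - {b})"
    unfolding deviation_def using True fin by (auto intro: prod.remove)
  moreover have "deviation (flip \<eta> b) (A - {b}) = deviation \<eta> (A - {b})"
    unfolding deviation_def by (intro prod.cong) (auto simp: flip_def)
  moreover have "(a * (1 - real (\<eta> b)) + g * real (\<eta> b)) * ((real (flip \<eta> b b) - \<rho>) - (real (\<eta> b) - \<rho>))
      = - (a + g) * (real (\<eta> b) - \<rho>)"
    using configs_values[OF assms(1,2)] assms(4) by (auto simp: flip_def algebra_simps)
  ultimately show ?thesis
    using True by (simp add: left_diff_distrib [symmetric] mult.assoc [symmetric])
next
  case False
  hence "deviation (flip \<eta> b) A = deviation \<eta> A"
    unfolding deviation_def by (intro prod.cong) (auto simp: flip_def)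
  thus ?thesis using False by simp
qed

text \<open>Both reservoirs having density \<open>\<rho>\<close>, products of deviations from \<open>\<rho>\<close> are dual functions
  between the process and the killed exclusion of their index sets.\<close>

lemma duality:
  assumes "\<eta> \<in> configs N" "A \<subseteq> {1..N}"
  shows "L (\<lambda>\<eta>. deviation \<eta> A) \<eta> = dual (deviation \<eta>) A"
  unfolding symmetric_generator[OF assms(1)] killed_exclusion_def deviation_exchange
    deviation_flip[OF assms(1) ends(1) assms(2) density(1)]
    deviation_flip[OF assms(1) ends(2) assms(2), of \<delta> \<beta>, unfolded add.commute[of \<delta>], OF density(2)]
  by (simp add: algebra_simps)

definition correlation :: "config \<Rightarrow> real \<Rightarrow> nat set \<Rightarrow> real" where
  "correlation \<eta> t A = op_exp L t (\<lambda>\<eta>. deviation \<eta> A) \<eta>"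

lemma correlation_0: "correlation \<eta> 0 A = deviation \<eta> A"
  by (simp add: correlation_def op_exp_0)

lemma killed_exclusion_eq_sum:
  obtains c B where "\<And>g. killed_exclusion N \<kappa>\<^sub>l \<kappa>\<^sub>r g A = (\<Sum>i<N. c i * g (B i))"
proof
  define k where "k = \<kappa>\<^sub>l * of_bool (1 \<in> A) + \<kappa>\<^sub>r * of_bool (N \<in> A)"
  define c where "c i = (if i = 0 then - (real N - 1) / 2 - k else 1 / 2)" for i :: nat
  define B where "B i = (if i = 0 then A else Transposition.transpose i (Suc i) ` A)" for i
  fix g
  have "{..<N} = insert 0 {1..<N}" using N by auto
  hence "(\<Sum>i<N. c i * g (B i)) = c 0 * g A + (\<Sum>i\<in>{1..<N}. c i * g (B i))"
    by (simp add: B_def)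
  also have "(\<Sum>i\<in>{1..<N}. c i * g (B i)) =
      (\<Sum>i\<in>{1..<N}. 1 / 2 * g (Transposition.transpose i (Suc i) ` A))"
    by (intro sum.cong) (auto simp: c_def B_def)
  finally have "(\<Sum>i<N. c i * g (B i)) =
      c 0 * g A + (\<Sum>i\<in>{1..<N}. 1 / 2 * g (Transposition.transpose i (Suc i) ` A))" .
  moreover have "killed_exclusion N \<kappa>\<^sub>l \<kappa>\<^sub>r g A =
      c 0 * g A + (\<Sum>i\<in>{1..<N}. 1 / 2 * g (Transposition.transpose i (Suc i) ` A))"
    using N unfolding killed_exclusion_def right_diff_distrib sum_subtractf k_def [symmetric]
    by (simp add: c_def of_nat_diff field_simps)
  ultimately show "killed_exclusion N \<kappa>\<^sub>l \<kappa>\<^sub>r g A = (\<Sum>i<N. c i * g (B i))" by simp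
qed

text \<open>Since the dual generator combines finitely many deviations, duality and linearity close the
  hierarchy of correlations degree by degree.\<close>

lemma correlation_deriv:
  assumes "\<eta> \<in> configs N" "A \<subseteq> {1..N}"
  shows "((\<lambda>t. correlation \<eta> t A) has_real_derivative dual (correlation \<eta> t) A) (at t)"
proof -
  obtain c B where cB: "\<And>g. dual g A = (\<Sum>i<N. c i * g (B i))"
    using killed_exclusion_eq_sum by blast
  have "op_exp L t (L (\<lambda>\<eta>. deviation \<eta> A)) \<eta> =
          op_exp L t (\<lambda>\<eta>. \<Sum>i<N. c i * deviation \<eta> (B i)) \<eta>"
    by (rule op_exp_cong) (use assms cB in \<open>auto simp: duality\<close>)
  also have "\<dots> = dual (correlation \<eta> t) A"
    by (simp add: op_exp_sum[OF _ assms(1)] cB correlation_def)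
  finally show ?thesis
    using op_exp_deriv[OF assms(1), of "\<lambda>\<eta>. deviation \<eta> A" t]
    by (simp add: correlation_def [abs_def])
qed

text \<open>The correlations solve the dual system exactly, and the product is a supersolution of it by
  Liggett's comparison. With \<open>\<sigma> = 1\<close> and \<open>\<sigma> = - 1\<close> this bounds absolute values.\<close>

lemma correlation_le_prod:
  assumes \<eta>: "\<eta> \<in> configs N"
    and deriv: "\<And>t x. t \<ge> 0 \<Longrightarrow> x \<in> {1..N} \<Longrightarrow> ((\<lambda>t. w t x) has_real_derivative w' t x) (at t)"
    and super: "\<And>t x. t \<ge> 0 \<Longrightarrow> x \<in> {1..N} \<Longrightarrow> walk (w t) x \<le> w' t x"
    and nonneg: "\<And>t x. t \<ge> 0 \<Longrightarrow> x \<in> {1..N} \<Longrightarrow> 0 \<le> w t x"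
    and init: "\<And>A. A \<subseteq> {1..N} \<Longrightarrow> \<sigma> * deviation \<eta> A \<le> prod (w 0) A"
    and t: "t \<ge> 0" and A: "A \<subseteq> {1..N}"
  shows "\<sigma> * correlation \<eta> t A \<le> prod (w t) A"
proof -
  have "0 \<le> prod (w t) A - \<sigma> * correlation \<eta> t A"
  proof (rule killed_exclusion_comparison[where N = N and \<kappa>\<^sub>l = "\<alpha> + \<gamma>" and \<kappa>\<^sub>r = "\<beta> + \<delta>"
        and v = "\<lambda>t A. prod (w t) A - \<sigma> * correlation \<eta> t A"
        and v' = "\<lambda>t A. (\<Sum>x\<in>A. w' t x * prod (w t) (A - {x})) - \<sigma> * dual (correlation \<eta> t) A"])
    fix t :: real and A assume t: "t \<ge> 0" and A: "A \<subseteq> {1..N}"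
    show "((\<lambda>t. prod (w t) A - \<sigma> * correlation \<eta> t A) has_real_derivative
        (\<Sum>x\<in>A. w' t x * prod (w t) (A - {x})) - \<sigma> * dual (correlation \<eta> t) A) (at t)"
      using t A
      by (intro DERIV_diff has_field_derivative_prod DERIV_cmult correlation_deriv \<eta> deriv) auto
    have "dual (prod (w t)) A \<le> (\<Sum>x\<in>A. walk (w t) x * prod (w t) (A - {x}))"
      by (rule killed_exclusion_prod_le) (use A t nonneg in auto)
    also have "\<dots> \<le> (\<Sum>x\<in>A. w' t x * prod (w t) (A - {x}))"
      using A t by (intro sum_mono mult_right_mono super prod_nonneg ballI nonneg) auto
    finally show "dual (\<lambda>A. prod (w t) A - \<sigma> * correlation \<eta> t A) A
        \<le> (\<Sum>x\<in>A. w' t x * prod (w t) (A - {x})) - \<sigma> * dual (correlation \<eta> t) A"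
      by (simp add: killed_exclusion_diff killed_exclusion_mult)
  qed (use rates init t A in \<open>auto simp: correlation_0\<close>)
  thus ?thesis by simp
qed

end

section \<open>The product measure and convergence to it\<close>

context equal_reservoirs
begin

abbreviation "site_variance \<equiv> \<rho> * (1 - \<rho>)"

lemma site_variance_pos: "0 < site_variance"
  using \<rho> by simp

definition product_measure :: "config pmf" where
  "product_measure = Pi_pmf {1..N} undefined (\<lambda>_. map_pmf of_bool (bernoulli_pmf \<rho>))"

lemma pmf_product_measure:
  assumes "\<eta> \<in> configs N"
  shows "pmf product_measure \<eta> = (\<Prod>x\<in>{1..N}. if \<eta> x = 1 then \<rho> else 1 - \<rho>)"
proof -
  have inj: "inj (of_bool :: bool \<Rightarrow> nat)" by (auto simp: inj_def of_bool_def)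
  have w: "pmf (map_pmf of_bool (bernoulli_pmf \<rho>)) (of_bool b :: nat) = (if b then \<rho> else 1 - \<rho>)"
    for b using \<rho> by (subst pmf_map_inj'[OF inj]) auto
  have "pmf (map_pmf of_bool (bernoulli_pmf \<rho>)) (\<eta> x) = (if \<eta> x = 1 then \<rho> else 1 - \<rho>)"
    if "x \<in> {1..N}" for x
    using configs_values[OF assms that] w[of True] w[of False] by auto
  thus ?thesis
    using assms unfolding product_measure_def configs_def
    by (subst pmf_Pi') (auto simp: PiE_iff extensional_def)
qed

lemma set_product_measure: "set_pmf product_measure \<subseteq> configs N"
proof
  fix \<eta> assume "\<eta> \<in> set_pmf product_measure"
  hence "\<eta> \<in> PiE_dflt {1..N} undefined (\<lambda>_. set_pmf (map_pmf of_bool (bernoulli_pmf \<rho>)))"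
    unfolding product_measure_def by (subst (asm) set_Pi_pmf) (auto simp: o_def)
  thus "\<eta> \<in> configs N"
    by (auto simp: PiE_dflt_def configs_def PiE_iff extensional_def of_bool_def)
qed

lemma sum_product_measure:
  "(\<Sum>\<eta>\<in>configs N. pmf product_measure \<eta> * (\<Prod>x\<in>{1..N}. h x (\<eta> x))) =
     (\<Prod>x\<in>{1..N}. \<rho> * h x 1 + (1 - \<rho>) * h x 0)"
proof -
  have "(\<Prod>x\<in>{1..N}. \<rho> * h x 1 + (1 - \<rho>) * h x 0) =
      (\<Prod>x\<in>{1..N}. \<Sum>k\<in>{0, 1::nat}. (if k = 1 then \<rho> else 1 - \<rho>) * h x k)"
    by (simp add: add.commute)
  also have "\<dots> = (\<Sum>\<eta>\<in>configs N. \<Prod>x\<in>{1..N}. (if \<eta> x = 1 then \<rho> else 1 - \<rho>) * h x (\<eta> x))"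
    unfolding configs_def by (subst prod_sum_PiE) auto
  also have "\<dots> = (\<Sum>\<eta>\<in>configs N. pmf product_measure \<eta> * (\<Prod>x\<in>{1..N}. h x (\<eta> x)))"
    by (intro sum.cong refl) (simp add: pmf_product_measure prod.distrib)
  finally show ?thesis ..
qed

lemma sum_pmf_product_measure: "(\<Sum>\<eta>\<in>configs N. pmf product_measure \<eta>) = 1"
  using set_product_measure by (intro sum_pmf_eq_1) auto

lemma deviation_eq_prod:
  "A \<subseteq> {1..N} \<Longrightarrow> deviation \<eta> A = (\<Prod>x\<in>{1..N}. if x \<in> A then real (\<eta> x) - \<rho> else 1)"
  unfolding deviation_def by (simp add: prod.If_cases Int_absorb1)

text \<open>Under the product measure the deviations at different sites are independent and centred with
  variance \<open>\<rho> * (1 - \<rho>)\<close>.\<close>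

lemma deviation_orthogonal:
  assumes A: "A \<subseteq> {1..N}" and B: "B \<subseteq> {1..N}"
  shows "(\<Sum>\<eta>\<in>configs N. pmf product_measure \<eta> * (deviation \<eta> A * deviation \<eta> B)) =
           of_bool (A = B) * site_variance ^ card A"
proof -
  define h where "h x k = (if x \<in> A then real k - \<rho> else 1) * (if x \<in> B then real k - \<rho> else 1)"
    for x k :: nat
  have "deviation \<eta> A * deviation \<eta> B = (\<Prod>x\<in>{1..N}. h x (\<eta> x))" for \<eta>
    by (simp only: deviation_eq_prod[OF A] deviation_eq_prod[OF B] h_def prod.distrib)
  hence "(\<Sum>\<eta>\<in>configs N. pmf product_measure \<eta> * (deviation \<eta> A * deviation \<eta> B)) =
      (\<Prod>x\<in>{1..N}. \<rho> * h x 1 + (1 - \<rho>) * h x 0)"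
    by (simp only: sum_product_measure)
  also have "\<dots> = of_bool (A = B) * site_variance ^ card A"
  proof (cases "A = B")
    case True
    have "\<rho> * h x 1 + (1 - \<rho>) * h x 0 = (if x \<in> A then site_variance else 1)" for x
      by (simp add: h_def True algebra_simps)
    thus ?thesis using A True by (simp add: prod.If_cases Int_absorb1)
  next
    case False
    then obtain x where x: "x \<in> {1..N}" "(x \<in> A) \<noteq> (x \<in> B)" using A B by blast
    have "\<rho> * h x 1 + (1 - \<rho>) * h x 0 = 0" using x(2) by (auto simp: h_def algebra_simps)
    hence "(\<Prod>x\<in>{1..N}. \<rho> * h x 1 + (1 - \<rho>) * h x 0) = 0"
      using x(1) by (intro prod_zero) auto
    thus ?thesis using False by simp
  qed
  finally show ?thesis .
qed

lemma indicator_expansion: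
  assumes \<eta>: "\<eta> \<in> configs N" and \<xi>: "\<xi> \<in> configs N"
  shows "indicator {\<xi>} \<eta> =
    (\<Sum>A\<in>Pow {1..N}. (pmf product_measure \<xi> * deviation \<xi> A / site_variance ^ card A) * deviation \<eta> A)"
proof -
  define d where "d x = (real (\<xi> x) - \<rho>) * (real (\<eta> x) - \<rho>) / site_variance" for x
  have "(\<Sum>A\<in>Pow {1..N}. (pmf product_measure \<xi> * deviation \<xi> A / site_variance ^ card A) * deviation \<eta> A) =
      pmf product_measure \<xi> * (\<Sum>A\<in>Pow {1..N}. prod d A * prod (\<lambda>_. 1) ({1..N} - A))"
    unfolding sum_distrib_left
    by (intro sum.cong refl) (simp add: d_def deviation_def prod_dividef prod.distrib prod_constant)
  also have "\<dots> = (\<Prod>x\<in>{1..N}. (if \<xi> x = 1 then \<rho> else 1 - \<rho>) * (d x + 1))"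
    by (subst prod_add [symmetric]) (simp_all add: pmf_product_measure[OF \<xi>] prod.distrib)
  also have "\<dots> = (\<Prod>x\<in>{1..N}. of_bool (\<xi> x = \<eta> x))"
  proof (intro prod.cong refl)
    fix x assume x: "x \<in> {1..N}"
    have "\<rho> \<noteq> 0" "1 - \<rho> \<noteq> 0" using \<rho> by auto
    with configs_values[OF \<eta> x] configs_values[OF \<xi> x]
    show "(if \<xi> x = 1 then \<rho> else 1 - \<rho>) * (d x + 1) = of_bool (\<xi> x = \<eta> x)"
      by - (elim disjE; simp add: d_def field_simps)
  qed
  also have "\<dots> = indicator {\<xi>} \<eta>"
  proof (cases "\<xi> = \<eta>")
    case False
    then obtain x where "x \<in> {1..N}" "\<xi> x \<noteq> \<eta> x"
      using \<eta> \<xi> unfolding configs_def by (metis PiE_ext)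
    hence "(\<Prod>x\<in>{1..N}. of_bool (\<xi> x = \<eta> x)) = (0 :: real)" by (intro prod_zero) auto
    thus ?thesis using False by simp
  qed simp
  finally show ?thesis ..
qed

lemma transition_prob_expansion:
  assumes \<eta>: "\<eta> \<in> configs N" and \<xi>: "\<xi> \<in> configs N"
  shows "transition_prob N (1 / 2) \<alpha> \<beta> \<gamma> \<delta> t \<eta> \<xi> =
    (\<Sum>A\<in>Pow {1..N}. (pmf product_measure \<xi> * deviation \<xi> A / site_variance ^ card A) * correlation \<eta> t A)"
proof -
  have "transition_prob N (1 / 2) \<alpha> \<beta> \<gamma> \<delta> t \<eta> \<xi> = op_exp L t (\<lambda>\<eta>.
      \<Sum>A\<in>Pow {1..N}. (pmf product_measure \<xi> * deviation \<xi> A / site_variance ^ card A) * deviation \<eta> A) \<eta>"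
    unfolding transition_prob_eq by (rule op_exp_cong[OF indicator_expansion[OF _ \<xi>] \<eta>])
  thus ?thesis by (simp only: op_exp_sum[OF _ \<eta>] finite_Pow_iff finite_atLeastAtMost correlation_def)
qed

lemma correlation_empty:
  assumes "\<eta> \<in> configs N"
  shows "correlation \<eta> t {} = 1"
proof -
  have "L (\<lambda>\<eta>. deviation \<eta> {}) \<xi> = 0" if "\<xi> \<in> configs N" for \<xi>
    using duality[OF that, of "{}"] by (simp add: killed_exclusion_def)
  from op_exp_stationary[OF this assms] show ?thesis
    by (simp add: correlation_def deviation_def)
qed

text \<open>The relative density of the law at time \<open>t\<close> has the correlations as its coefficients in the
  orthogonal system of the deviations, so its variance is a sum of squares by Parseval. The
  Cauchy-Schwarz inequality passes from \<open>L\<^sup>2\<close> to total variation.\<close>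

lemma tv_dist_le_chi_square:
  assumes \<eta>: "\<eta> \<in> configs N"
  shows "tv_dist N (transition_prob N (1 / 2) \<alpha> \<beta> \<gamma> \<delta> t \<eta>) (pmf product_measure) \<le>
    1 / 2 * sqrt (\<Sum>A\<in>Pow {1..N} - {{}}. (correlation \<eta> t A)\<^sup>2 / site_variance ^ card A)"
proof -
  define I where "I = Pow {1..N} - {{}}"
  have fin: "finite I" by (simp add: I_def)
  define c where "c A = correlation \<eta> t A / site_variance ^ card A" for A
  define h where "h \<xi> = (\<Sum>A\<in>I. c A * deviation \<xi> A)" for \<xi>
  let ?m = "pmf product_measure"
  have diff: "transition_prob N (1 / 2) \<alpha> \<beta> \<gamma> \<delta> t \<eta> \<xi> - ?m \<xi> = ?m \<xi> * h \<xi>"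
    if "\<xi> \<in> configs N" for \<xi>
  proof -
    have "transition_prob N (1 / 2) \<alpha> \<beta> \<gamma> \<delta> t \<eta> \<xi> =
        ?m \<xi> + (\<Sum>A\<in>I. (?m \<xi> * deviation \<xi> A / site_variance ^ card A) * correlation \<eta> t A)"
      unfolding transition_prob_expansion[OF \<eta> that] I_def
      by (subst sum.remove[of _ "{}"]) (auto simp: correlation_empty[OF \<eta>] deviation_def)
    thus ?thesis by (simp add: h_def c_def sum_distrib_left mult_ac)
  qed
  have "(\<Sum>\<xi>\<in>configs N. ?m \<xi> * (h \<xi>)\<^sup>2) =
      (\<Sum>\<xi>\<in>configs N. \<Sum>A\<in>I. \<Sum>B\<in>I. c A * c B * (?m \<xi> * (deviation \<xi> A * deviation \<xi> B)))"
    by (simp add: h_def power2_eq_square sum_product sum_distrib_left mult_ac)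
  also have "\<dots> = (\<Sum>A\<in>I. \<Sum>B\<in>I. c A * c B *
      (\<Sum>\<xi>\<in>configs N. ?m \<xi> * (deviation \<xi> A * deviation \<xi> B)))"
    unfolding sum_distrib_left by (subst sum.swap, intro sum.cong refl, rule sum.swap)
  also have "\<dots> = (\<Sum>A\<in>I. \<Sum>B\<in>I. if A = B then c A * c B * site_variance ^ card A else 0)"
    by (intro sum.cong refl) (auto simp: I_def deviation_orthogonal)
  also have "\<dots> = (\<Sum>A\<in>I. c A * c A * site_variance ^ card A)"
    using fin by simp
  also have "\<dots> = (\<Sum>A\<in>I. (correlation \<eta> t A)\<^sup>2 / site_variance ^ card A)"
  proof (intro sum.cong refl)
    fix A :: "nat set"
    define q where "q = site_variance ^ card A"
    have "q \<noteq> 0" using \<rho> by (simp add: q_def)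
    thus "c A * c A * site_variance ^ card A = (correlation \<eta> t A)\<^sup>2 / site_variance ^ card A"
      unfolding c_def q_def [symmetric] by (simp add: power2_eq_square)
  qed
  finally have second_moment:
    "(\<Sum>\<xi>\<in>configs N. ?m \<xi> * (h \<xi>)\<^sup>2) = (\<Sum>A\<in>I. (correlation \<eta> t A)\<^sup>2 / site_variance ^ card A)" .
  have "(\<Sum>\<xi>\<in>configs N. sqrt (?m \<xi>) * (sqrt (?m \<xi>) * \<bar>h \<xi>\<bar>))\<^sup>2 \<le>
      (\<Sum>\<xi>\<in>configs N. (sqrt (?m \<xi>))\<^sup>2) * (\<Sum>\<xi>\<in>configs N. (sqrt (?m \<xi>) * \<bar>h \<xi>\<bar>)\<^sup>2)"
    by (rule Cauchy_Schwarz_ineq_sum)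
  hence "(\<Sum>\<xi>\<in>configs N. ?m \<xi> * \<bar>h \<xi>\<bar>)\<^sup>2 \<le> (\<Sum>\<xi>\<in>configs N. ?m \<xi> * (h \<xi>)\<^sup>2)"
    by (simp add: mult.assoc [symmetric] power_mult_distrib sum_pmf_product_measure)
  hence "(\<Sum>\<xi>\<in>configs N. ?m \<xi> * \<bar>h \<xi>\<bar>) \<le> sqrt (\<Sum>A\<in>I. (correlation \<eta> t A)\<^sup>2 / site_variance ^ card A)"
    unfolding second_moment by (rule real_le_rsqrt)
  moreover have "(\<Sum>\<xi>\<in>configs N. \<bar>transition_prob N (1 / 2) \<alpha> \<beta> \<gamma> \<delta> t \<eta> \<xi> - ?m \<xi>\<bar>) =
      (\<Sum>\<xi>\<in>configs N. ?m \<xi> * \<bar>h \<xi>\<bar>)"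
    by (intro sum.cong refl) (simp add: diff abs_mult)
  ultimately show ?thesis by (simp add: tv_dist_def I_def)
qed

lemma abs_deviation_le_1:
  assumes "\<eta> \<in> configs N" "A \<subseteq> {1..N}"
  shows "\<bar>deviation \<eta> A\<bar> \<le> 1"
  unfolding deviation_def abs_prod
proof (rule prod_le_1)
  fix x assume "x \<in> A"
  hence "x \<in> {1..N}" using assms(2) by blast
  from configs_values[OF assms(1) this]
  show "0 \<le> \<bar>real (\<eta> x) - \<rho>\<bar> \<and> \<bar>real (\<eta> x) - \<rho>\<bar> \<le> 1"
    using \<rho> by auto
qed

text \<open>A positive supersolution \<open>\<phi>\<close> of the walk bounds every correlation by a product over its sites,
  so the sum of squares factorizes over the sites. The exponent is of order \<open>N * exp (- 2 * l * t)\<close>: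
  squaring is what halves the time \<open>ln N / l\<close> after which few of \<open>N\<close> independent walkers, one from each
  site, survive.\<close>

lemma tv_dist_upper_bound:
  assumes \<eta>: "\<eta> \<in> configs N" and t: "t \<ge> 0" and c: "0 < c"
    and \<phi>: "\<And>x. x \<in> {1..N} \<Longrightarrow> c \<le> \<phi> x \<and> \<phi> x \<le> 1"
    and super: "\<And>x. x \<in> {1..N} \<Longrightarrow> walk \<phi> x \<le> - l * \<phi> x"
  shows "tv_dist N (transition_prob N (1 / 2) \<alpha> \<beta> \<gamma> \<delta> t \<eta>) (pmf product_measure) \<le>
    1 / 2 * sqrt (exp (real N * exp (- 2 * l * t) / (c\<^sup>2 * site_variance)) - 1)"
proof -
  define w where "w t x = exp (- l * t) / c * \<phi> x" for t x
  have le: "\<sigma> * correlation \<eta> t A \<le> prod (w t) A"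
    if A: "A \<subseteq> {1..N}" and \<sigma>: "\<bar>\<sigma>\<bar> = 1" for \<sigma> A
  proof (rule correlation_le_prod[where w' = "\<lambda>t x. - l * w t x"])
    fix t x
    show "((\<lambda>t. w t x) has_real_derivative - l * w t x) (at t)"
      unfolding w_def using c by (auto intro!: derivative_eq_intros)
    assume x: "x \<in> {1..N}"
    have "exp (- l * t) / c * walk \<phi> x \<le> exp (- l * t) / c * (- l * \<phi> x)"
      using c by (intro mult_left_mono super x) auto
    thus "walk (w t) x \<le> - l * w t x"
      unfolding w_def killed_walk_mult by (simp add: mult_ac)
    show "0 \<le> w t x" using \<phi>[OF x] c by (simp add: w_def)
  next
    fix B assume B: "B \<subseteq> {1..N}"
    have "\<sigma> * deviation \<eta> B \<le> \<bar>\<sigma> * deviation \<eta> B\<bar>" by (rule abs_ge_self)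
    also have "\<dots> \<le> 1" using abs_deviation_le_1[OF \<eta> B] by (simp add: abs_mult \<sigma>)
    also have "1 \<le> prod (w 0) B"
      using \<phi> B c by (intro prod_ge_1) (auto simp: w_def)
    finally show "\<sigma> * deviation \<eta> B \<le> prod (w 0) B" .
  qed (use \<eta> t A in auto)
  have sq: "(correlation \<eta> t A)\<^sup>2 / site_variance ^ card A \<le> (\<Prod>x\<in>A. (w t x)\<^sup>2 / site_variance)"
    if A: "A \<subseteq> {1..N}" for A
  proof -
    have "\<bar>correlation \<eta> t A\<bar> \<le> prod (w t) A"
      using le[OF A, of 1] le[OF A, of "-1"] by auto
    hence "(correlation \<eta> t A)\<^sup>2 \<le> (prod (w t) A)\<^sup>2"
      by (metis abs_le_square_iff abs_of_nonneg abs_ge_zero order_trans)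
    thus ?thesis
      using site_variance_pos by (simp add: prod_dividef prod_power_distrib divide_right_mono)
  qed
  have "(\<Sum>A\<in>Pow {1..N} - {{}}. (correlation \<eta> t A)\<^sup>2 / site_variance ^ card A) \<le>
      (\<Sum>A\<in>Pow {1..N} - {{}}. \<Prod>x\<in>A. (w t x)\<^sup>2 / site_variance)"
    by (intro sum_mono sq) auto
  also have "\<dots> = (\<Sum>A\<in>Pow {1..N}. \<Prod>x\<in>A. (w t x)\<^sup>2 / site_variance) - 1"
    by (subst sum.remove[of "Pow {1..N}" "{}"]) auto
  also have "(\<Sum>A\<in>Pow {1..N}. \<Prod>x\<in>A. (w t x)\<^sup>2 / site_variance) = (\<Prod>x\<in>{1..N}. (w t x)\<^sup>2 / site_variance + 1)"
    by (subst prod_add) auto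
  also have "(\<Prod>x\<in>{1..N}. (w t x)\<^sup>2 / site_variance + 1) \<le> (\<Prod>x\<in>{1..N}. exp (exp (- 2 * l * t) / (c\<^sup>2 * site_variance)))"
  proof (rule prod_mono)
    fix x assume x: "x \<in> {1..N}"
    have "(w t x)\<^sup>2 / site_variance + 1 \<le> exp ((w t x)\<^sup>2 / site_variance)"
      using exp_ge_add_one_self[of "(w t x)\<^sup>2 / site_variance"] by linarith
    moreover have "(w t x)\<^sup>2 / site_variance \<le> exp (- 2 * l * t) / (c\<^sup>2 * site_variance)"
    proof -
      have "(exp (- l * t))\<^sup>2 = exp (- 2 * l * t)"
        by (simp add: power2_eq_square exp_add [symmetric])
      hence "(w t x)\<^sup>2 / site_variance = exp (- 2 * l * t) / (c\<^sup>2 * site_variance) * (\<phi> x)\<^sup>2"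
        by (simp add: w_def power_mult_distrib power_divide)
      also have "\<dots> \<le> exp (- 2 * l * t) / (c\<^sup>2 * site_variance) * 1"
        using \<phi>[OF x] c site_variance_pos by (intro mult_left_mono) (auto simp: power_le_one)
      finally show ?thesis by simp
    qed
    ultimately show "0 \<le> (w t x)\<^sup>2 / site_variance + 1 \<and>
        (w t x)\<^sup>2 / site_variance + 1 \<le> exp (exp (- 2 * l * t) / (c\<^sup>2 * site_variance))"
      using site_variance_pos by (auto intro: order_trans)
  qed
  also have "\<dots> = exp (real N * exp (- 2 * l * t) / (c\<^sup>2 * site_variance))"
    by (simp add: exp_of_nat_mult [symmetric])
  finally have "(\<Sum>A\<in>Pow {1..N} - {{}}. (correlation \<eta> t A)\<^sup>2 / site_variance ^ card A) \<le>
      exp (real N * exp (- 2 * l * t) / (c\<^sup>2 * site_variance)) - 1" by simp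
  thus ?thesis
    using tv_dist_le_chi_square[OF \<eta>, of t] by (meson mult_left_mono order_trans real_sqrt_le_mono
      zero_le_divide_1_iff zero_le_numeral)
qed

text \<open>Averaged over the product measure the correlations still solve the dual system, and their
  initial value, the indicator of the empty set, is a fixed point of it.\<close>

lemma sum_correlation:
  assumes t: "t \<ge> 0" and A: "A \<subseteq> {1..N}"
  shows "(\<Sum>\<eta>\<in>configs N. pmf product_measure \<eta> * correlation \<eta> t A) = of_bool (A = {})"
proof -
  define h where "h t A = (\<Sum>\<eta>\<in>configs N. pmf product_measure \<eta> * correlation \<eta> t A)" for t A
  have deriv: "((\<lambda>t. h t A) has_real_derivative dual (h t) A) (at t)" if A: "A \<subseteq> {1..N}" for t A
  proof -
    obtain c B where cB: "\<And>g. dual g A = (\<Sum>i<N. c i * g (B i))"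
      using killed_exclusion_eq_sum by blast
    have "dual (h t) A = (\<Sum>\<eta>\<in>configs N. pmf product_measure \<eta> * dual (correlation \<eta> t) A)"
      unfolding cB h_def sum_distrib_left by (subst sum.swap) (simp add: mult_ac)
    thus ?thesis
      unfolding h_def by (auto intro!: DERIV_sum DERIV_cmult correlation_deriv A)
  qed
  have h0: "h 0 A = of_bool (A = {})" if "A \<subseteq> {1..N}" for A
    using deviation_orthogonal[OF that, of "{}"]
    by (simp add: h_def correlation_0 deviation_def)
  have empty: "dual (\<lambda>A. of_bool (A = {})) A = 0" for A
    by (auto simp: killed_exclusion_def)
  have "0 \<le> \<sigma> * (h t A - of_bool (A = {}))" for \<sigma>
  proof (rule killed_exclusion_comparison[where N = N and \<kappa>\<^sub>l = "\<alpha> + \<gamma>" and \<kappa>\<^sub>r = "\<beta> + \<delta>"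
        and v = "\<lambda>t A. \<sigma> * (h t A - of_bool (A = {}))" and v' = "\<lambda>t A. \<sigma> * dual (h t) A"])
    fix t A assume A: "A \<subseteq> {1..N}"
    show "((\<lambda>t. \<sigma> * (h t A - of_bool (A = {}))) has_real_derivative \<sigma> * dual (h t) A) (at t)"
      using deriv[OF A] by (auto intro!: derivative_eq_intros)
    show "dual (\<lambda>A. \<sigma> * (h t A - of_bool (A = {}))) A \<le> \<sigma> * dual (h t) A"
      by (simp add: killed_exclusion_mult killed_exclusion_diff empty)
  qed (use rates h0 t A in auto)
  from this[of 1] this[of "-1"] show ?thesis by (simp add: h_def)
qed

lemma product_measure_stationary: "is_stationary N (1 / 2) \<alpha> \<beta> \<gamma> \<delta> product_measure"
  unfolding is_stationary_def
proof (intro conjI allI ballI impI set_product_measure)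
  fix t :: real and \<xi> assume t: "0 \<le> t" and \<xi>: "\<xi> \<in> configs N"
  let ?m = "pmf product_measure"
  have "(\<Sum>\<eta>\<in>configs N. ?m \<eta> * transition_prob N (1 / 2) \<alpha> \<beta> \<gamma> \<delta> t \<eta> \<xi>) =
      (\<Sum>\<eta>\<in>configs N. \<Sum>A\<in>Pow {1..N}.
        (?m \<xi> * deviation \<xi> A / site_variance ^ card A) * (?m \<eta> * correlation \<eta> t A))"
    by (intro sum.cong refl)
       (simp add: transition_prob_expansion \<xi> sum_distrib_left mult_ac)
  also have "\<dots> = (\<Sum>A\<in>Pow {1..N}. (?m \<xi> * deviation \<xi> A / site_variance ^ card A) *
      (\<Sum>\<eta>\<in>configs N. ?m \<eta> * correlation \<eta> t A))"
    unfolding sum_distrib_left by (rule sum.swap)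
  also have "\<dots> = (\<Sum>A\<in>Pow {1..N}. if A = {} then ?m \<xi> else 0)"
    by (intro sum.cong refl) (auto simp: sum_correlation t deviation_def)
  finally show "(\<Sum>\<eta>\<in>configs N. ?m \<eta> * transition_prob N (1 / 2) \<alpha> \<beta> \<gamma> \<delta> t \<eta> \<xi>) = ?m \<xi>"
    by (simp add: sum.delta)
qed

text \<open>Convergence from every starting point leaves no room for a second stationary distribution.\<close>

lemma stationary_dist_eq:
  assumes c: "0 < c"
    and \<phi>: "\<And>x. x \<in> {1..N} \<Longrightarrow> c \<le> \<phi> x \<and> \<phi> x \<le> 1"
    and super: "\<And>x. x \<in> {1..N} \<Longrightarrow> walk \<phi> x \<le> - l * \<phi> x"
    and l: "0 < l"
  shows "stationary_dist N (1 / 2) \<alpha> \<beta> \<gamma> \<delta> = product_measure"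
  unfolding stationary_dist_def
proof (rule the_equality, rule product_measure_stationary)
  fix \<nu> assume \<nu>: "is_stationary N (1 / 2) \<alpha> \<beta> \<gamma> \<delta> \<nu>"
  let ?m = "pmf product_measure"
  let ?p = "\<lambda>t \<eta> \<xi>. transition_prob N (1 / 2) \<alpha> \<beta> \<gamma> \<delta> t \<eta> \<xi>"
  let ?b = "\<lambda>t. sqrt (exp (real N * exp (- 2 * l * t) / (c\<^sup>2 * site_variance)) - 1)"
  have supp: "set_pmf \<nu> \<subseteq> configs N" using \<nu> by (simp add: is_stationary_def)
  have sum1: "(\<Sum>\<eta>\<in>configs N. pmf \<nu> \<eta>) = 1" using supp by (intro sum_pmf_eq_1) auto
  have "((\<lambda>t. exp (- 2 * l * t)) \<longlongrightarrow> 0) at_top"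
    using l by real_asymp
  hence lim: "(?b \<longlongrightarrow> sqrt (exp (real N * 0 / (c\<^sup>2 * site_variance)) - 1)) at_top"
    by (intro tendsto_intros) (use c site_variance_pos in auto)
  have "pmf \<nu> \<xi> = ?m \<xi>" if \<xi>: "\<xi> \<in> configs N" for \<xi>
  proof -
    have "\<bar>pmf \<nu> \<xi> - ?m \<xi>\<bar> \<le> ?b t" if t: "t \<ge> 0" for t
    proof -
      have p: "\<bar>?p t \<eta> \<xi> - ?m \<xi>\<bar> \<le> ?b t" if \<eta>: "\<eta> \<in> configs N" for \<eta>
      proof -
        have "\<bar>?p t \<eta> \<xi> - ?m \<xi>\<bar> \<le> (\<Sum>\<xi>\<in>configs N. \<bar>?p t \<eta> \<xi> - ?m \<xi>\<bar>)"
          by (rule member_le_sum[OF \<xi>]) auto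
        also have "\<dots> = 2 * tv_dist N (?p t \<eta>) ?m" by (simp add: tv_dist_def)
        finally show ?thesis using tv_dist_upper_bound[OF \<eta> t c \<phi> super] by simp
      qed
      have "pmf \<nu> \<xi> = (\<Sum>\<eta>\<in>configs N. pmf \<nu> \<eta> * ?p t \<eta> \<xi>)"
        using \<nu> t \<xi> by (simp add: is_stationary_def)
      hence "\<bar>pmf \<nu> \<xi> - ?m \<xi>\<bar> = \<bar>\<Sum>\<eta>\<in>configs N. pmf \<nu> \<eta> * (?p t \<eta> \<xi> - ?m \<xi>)\<bar>"
        by (simp add: right_diff_distrib sum_subtractf sum_distrib_right [symmetric] sum1)
      also have "\<dots> \<le> (\<Sum>\<eta>\<in>configs N. pmf \<nu> \<eta> * ?b t)"
        by (rule order_trans[OF sum_abs])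
           (intro sum_mono, simp only: abs_mult abs_of_nonneg[OF pmf_nonneg],
            intro mult_left_mono p pmf_nonneg)
      finally show ?thesis by (simp add: sum_distrib_right [symmetric] sum1)
    qed
    hence "eventually (\<lambda>t. \<bar>pmf \<nu> \<xi> - ?m \<xi>\<bar> \<le> ?b t) at_top"
      by - (rule eventually_mono[OF eventually_ge_at_top[of 0]], blast)
    from tendsto_lowerbound[OF lim this] show ?thesis by simp
  qed
  moreover have "pmf \<nu> \<xi> = ?m \<xi>" if "\<xi> \<notin> configs N" for \<xi>
    using that supp set_product_measure by (metis pmf_eq_0_set_pmf subsetD)
  ultimately show "\<nu> = product_measure" by (intro pmf_eqI) blast
qed

end

section \<open>The lower bound: fluctuations of the particle number\<close>

text \<open>By Chebyshev the event \<open>f \<ge> m / 2\<close> has probability close to \<open>1\<close> under \<open>p\<close> and close to \<open>0\<close>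
  under \<open>q\<close>.\<close>

lemma total_variation_ge_second_moment:
  fixes p q f :: "'a \<Rightarrow> real"
  assumes p: "\<And>x. x \<in> S \<Longrightarrow> 0 \<le> p x" "(\<Sum>x\<in>S. p x) = 1"
    and q: "\<And>x. x \<in> S \<Longrightarrow> 0 \<le> q x" "(\<Sum>x\<in>S. q x) = 1"
    and m: "(\<Sum>x\<in>S. p x * f x) = m" "0 < m"
    and var: "(\<Sum>x\<in>S. p x * (f x)\<^sup>2) \<le> m\<^sup>2 + K" "(\<Sum>x\<in>S. q x * (f x)\<^sup>2) \<le> K"
  shows "1 - 8 * K / m\<^sup>2 \<le> 1 / 2 * (\<Sum>x\<in>S. \<bar>p x - q x\<bar>)"
proof -
  define b where "b x = (of_bool (m / 2 \<le> f x) :: real)" for x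
  have "(\<Sum>x\<in>S. p x * (1 - b x)) \<le> (\<Sum>x\<in>S. 4 / m\<^sup>2 * (p x * (f x - m)\<^sup>2))"
  proof (rule sum_mono)
    fix x assume x: "x \<in> S"
    have "1 - b x \<le> 4 / m\<^sup>2 * (f x - m)\<^sup>2"
    proof (cases "m / 2 \<le> f x")
      case False
      hence "(m / 2)\<^sup>2 \<le> (m - f x)\<^sup>2" using m(2) by (intro power_mono) auto
      thus ?thesis using m(2) False
        by (simp add: b_def field_simps power2_commute[of m])
    qed (simp add: b_def)
    from mult_left_mono[OF this p(1)[OF x]]
    show "p x * (1 - b x) \<le> 4 / m\<^sup>2 * (p x * (f x - m)\<^sup>2)" by (simp add: mult_ac)
  qed
  also have "\<dots> = 4 / m\<^sup>2 * (\<Sum>x\<in>S. p x * (f x - m)\<^sup>2)" by (simp add: sum_distrib_left)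
  also have "(\<Sum>x\<in>S. p x * (f x - m)\<^sup>2) =
      (\<Sum>x\<in>S. p x * (f x)\<^sup>2) - 2 * m * (\<Sum>x\<in>S. p x * f x) + m\<^sup>2 * (\<Sum>x\<in>S. p x)"
    by (simp add: sum_distrib_left sum.distrib [symmetric] sum_subtractf [symmetric]
        power2_eq_square algebra_simps)
  also have "\<dots> \<le> K" using var(1) m p(2) by (simp add: power2_eq_square)
  finally have "(\<Sum>x\<in>S. p x * (1 - b x)) \<le> 4 / m\<^sup>2 * K"
    using m(2) by (simp add: divide_right_mono)
  hence pb: "1 - 4 * K / m\<^sup>2 \<le> (\<Sum>x\<in>S. p x * b x)"
    using p(2) by (simp add: right_diff_distrib sum_subtractf)
  have "(\<Sum>x\<in>S. q x * b x) \<le> (\<Sum>x\<in>S. 4 / m\<^sup>2 * (q x * (f x)\<^sup>2))"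
  proof (rule sum_mono)
    fix x assume x: "x \<in> S"
    have "b x \<le> 4 / m\<^sup>2 * (f x)\<^sup>2"
    proof (cases "m / 2 \<le> f x")
      case True
      hence "(m / 2)\<^sup>2 \<le> (f x)\<^sup>2" using m(2) by (intro power_mono) auto
      thus ?thesis using m(2) True by (simp add: b_def field_simps)
    qed (simp add: b_def)
    from mult_left_mono[OF this q(1)[OF x]]
    show "q x * b x \<le> 4 / m\<^sup>2 * (q x * (f x)\<^sup>2)" by (simp add: mult_ac)
  qed
  also have "\<dots> = 4 / m\<^sup>2 * (\<Sum>x\<in>S. q x * (f x)\<^sup>2)" by (simp add: sum_distrib_left)
  also have "\<dots> \<le> 4 / m\<^sup>2 * K" using var(2) by (intro mult_left_mono) auto
  finally have qb: "(\<Sum>x\<in>S. q x * b x) \<le> 4 * K / m\<^sup>2" by simp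
  have "2 * (\<Sum>x\<in>S. p x * b x) - 2 * (\<Sum>x\<in>S. q x * b x) =
      (\<Sum>x\<in>S. (p x - q x) * (2 * b x - 1)) + ((\<Sum>x\<in>S. p x) - (\<Sum>x\<in>S. q x))"
    by (simp add: sum_distrib_left sum.distrib [symmetric] sum_subtractf [symmetric] algebra_simps)
  also have "\<dots> \<le> (\<Sum>x\<in>S. \<bar>p x - q x\<bar>)"
    unfolding p(2) q(2) by (simp, intro sum_mono) (auto simp: b_def)
  finally show ?thesis using pb qb by simp
qed

context equal_reservoirs
begin

lemma transition_prob_nonneg:
  assumes "\<eta> \<in> configs N" "\<xi> \<in> configs N" "0 \<le> t"
  shows "0 \<le> transition_prob N (1 / 2) \<alpha> \<beta> \<gamma> \<delta> t \<eta> \<xi>"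
  unfolding transition_prob_eq
proof (rule op_exp_indicator_nonneg)
  fix \<xi> \<zeta> assume \<zeta>: "\<zeta> \<in> configs N" and "\<xi> \<noteq> \<zeta>"
  hence 0: "indicator {\<xi>} \<zeta> = (0 :: real)" by simp
  have "0 \<le> (a * (1 - real (\<zeta> x)) + g * real (\<zeta> x)) * indicator {\<xi>} (flip \<zeta> x)"
    if "x \<in> {1..N}" "0 \<le> a" "0 \<le> g" for x a g
    using configs_values[OF \<zeta> that(1)] that by auto
  from this[OF ends(1) rates(1,3)] this[OF ends(2) rates(4,2)]
  show "0 \<le> L (indicator {\<xi>}) \<zeta>"
    unfolding symmetric_generator[OF \<zeta>] 0
    by (intro add_nonneg_nonneg sum_nonneg) auto
qed (use assms in auto)

lemma transition_prob_expectation: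
  assumes "\<eta> \<in> configs N"
  shows "(\<Sum>\<xi>\<in>configs N. transition_prob N (1 / 2) \<alpha> \<beta> \<gamma> \<delta> t \<eta> \<xi> * f \<xi>) = op_exp L t f \<eta>"
proof -
  have "op_exp L t f \<eta> = op_exp L t (\<lambda>\<eta>. \<Sum>\<xi>\<in>configs N. f \<xi> * indicator {\<xi>} \<eta>) \<eta>"
    by (rule op_exp_cong) (auto simp: assms indicator_def if_distrib cong: if_cong)
  also have "\<dots> = (\<Sum>\<xi>\<in>configs N. f \<xi> * op_exp L t (indicator {\<xi>}) \<eta>)"
    using assms by (intro op_exp_sum) auto
  finally show ?thesis by (simp add: transition_prob_eq mult.commute)
qed

lemma sum_transition_prob:
  assumes "\<eta> \<in> configs N"
  shows "(\<Sum>\<xi>\<in>configs N. transition_prob N (1 / 2) \<alpha> \<beta> \<gamma> \<delta> t \<eta> \<xi>) = 1"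
  using transition_prob_expectation[OF assms, of t "\<lambda>\<eta>. deviation \<eta> {}"]
    correlation_empty[OF assms, of t]
  by (simp add: correlation_def deviation_def)

definition full :: config where
  "full = (\<lambda>x\<in>{1..N}. 1)"

lemma full_in_configs: "full \<in> configs N"
  by (auto simp: full_def configs_def)

lemma deviation_full: "A \<subseteq> {1..N} \<Longrightarrow> deviation full A = (1 - \<rho>) ^ card A"
  unfolding deviation_def by (subst prod_constant [symmetric], intro prod.cong) (auto simp: full_def)

text \<open>The one-site correlations solve the equation of the killed walk, and a subsolution below them at
  time \<open>0\<close> stays below.\<close>

lemma correlation_full_ge:
  assumes t: "t \<ge> 0" and x: "x \<in> {1..N}"
    and \<phi>: "\<And>x. x \<in> {1..N} \<Longrightarrow> 0 \<le> \<phi> x \<and> \<phi> x \<le> 1"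
    and sub: "\<And>x. x \<in> {1..N} \<Longrightarrow> - l * \<phi> x \<le> walk \<phi> x"
  shows "(1 - \<rho>) * exp (- l * t) * \<phi> x \<le> correlation full t {x}"
proof -
  define u where "u t x = correlation full t {x}" for t x
  have "0 \<le> u t x - (1 - \<rho>) * exp (- l * t) * \<phi> x"
  proof (rule killed_walk_comparison[where N = N and \<kappa>\<^sub>l = "\<alpha> + \<gamma>" and \<kappa>\<^sub>r = "\<beta> + \<delta>"
        and v = "\<lambda>t x. u t x - (1 - \<rho>) * exp (- l * t) * \<phi> x"
        and v' = "\<lambda>t x. walk (u t) x + l * ((1 - \<rho>) * exp (- l * t) * \<phi> x)"])
    fix t x assume x: "x \<in> {1..N}"
    have "((\<lambda>t. u t x) has_real_derivative walk (u t) x) (at t)"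
      using correlation_deriv[OF full_in_configs, of "{x}" t] x
      by (simp add: u_def [abs_def] killed_exclusion_singleton)
    moreover have "((\<lambda>t. (1 - \<rho>) * exp (- l * t) * \<phi> x) has_real_derivative
        - (l * ((1 - \<rho>) * exp (- l * t) * \<phi> x))) (at t)"
      by (auto intro!: derivative_eq_intros)
    ultimately show "((\<lambda>t. u t x - (1 - \<rho>) * exp (- l * t) * \<phi> x) has_real_derivative
        walk (u t) x + l * ((1 - \<rho>) * exp (- l * t) * \<phi> x)) (at t)"
      by (auto dest: DERIV_diff)
    have "(1 - \<rho>) * exp (- l * t) * (- l * \<phi> x) \<le> (1 - \<rho>) * exp (- l * t) * walk \<phi> x"
      using \<rho> by (intro mult_left_mono sub x) auto
    thus "walk (\<lambda>x. u t x - (1 - \<rho>) * exp (- l * t) * \<phi> x) x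
        \<le> walk (u t) x + l * ((1 - \<rho>) * exp (- l * t) * \<phi> x)"
      unfolding killed_walk_diff killed_walk_mult by (simp add: mult_ac)
  next
    fix x assume x: "x \<in> {1..N}"
    hence "u 0 x = 1 - \<rho>" by (simp add: u_def correlation_0 deviation_full)
    moreover have "(1 - \<rho>) * \<phi> x \<le> (1 - \<rho>) * 1"
      using \<phi>[OF x] \<rho> by (intro mult_left_mono) auto
    ultimately show "0 \<le> u 0 x - (1 - \<rho>) * exp (- l * 0) * \<phi> x" by simp
  qed (use rates t x in auto)
  thus ?thesis by (simp add: u_def)
qed

lemma correlation_full_nonneg: "t \<ge> 0 \<Longrightarrow> x \<in> {1..N} \<Longrightarrow> 0 \<le> correlation full t {x}"
  using correlation_full_ge[of t x "\<lambda>_. 0" 0] by (simp add: killed_walk_def)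

text \<open>The comparison with a product is applied to the one-site correlations themselves: from the full
  configuration the initial correlations are exact products.\<close>

lemma negative_correlation:
  assumes t: "t \<ge> 0" and "x \<in> {1..N}" "y \<in> {1..N}" "x \<noteq> y"
  shows "correlation full t {x, y} \<le> correlation full t {x} * correlation full t {y}"
proof -
  have "1 * correlation full t {x, y} \<le> (\<Prod>z\<in>{x, y}. correlation full t {z})"
  proof (rule correlation_le_prod[where w = "\<lambda>t x. correlation full t {x}"
        and w' = "\<lambda>t x. walk (\<lambda>x. correlation full t {x}) x"])
    fix t x assume "x \<in> {1..N}"
    thus "((\<lambda>t. correlation full t {x}) has_real_derivative
        walk (\<lambda>x. correlation full t {x}) x) (at t)"
      using correlation_deriv[OF full_in_configs, of "{x}" t]
      by (simp add: killed_exclusion_singleton)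
  next
    fix A assume A: "A \<subseteq> {1..N}"
    have "(\<Prod>x\<in>A. correlation full 0 {x}) = (\<Prod>x\<in>A. 1 - \<rho>)"
      using A by (intro prod.cong) (auto simp: correlation_0 deviation_full)
    thus "1 * deviation full A \<le> (\<Prod>x\<in>A. correlation full 0 {x})"
      using A by (simp add: deviation_full)
  qed (use assms full_in_configs correlation_full_nonneg in auto)
  thus ?thesis using assms by simp
qed

text \<open>Distinguishing statistic: the excess of the particle number over its equilibrium mean. Its
  variance is at most \<open>N\<close>, in equilibrium by independence and at time \<open>t\<close> by negative correlation,
  while its mean is still of order \<open>N * exp (- l * t)\<close>.\<close>

lemma tv_dist_lower_bound:
  assumes t: "t \<ge> 0"
    and \<phi>: "\<And>x. x \<in> {1..N} \<Longrightarrow> 0 \<le> \<phi> x \<and> \<phi> x \<le> 1"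
    and sub: "\<And>x. x \<in> {1..N} \<Longrightarrow> - l * \<phi> x \<le> walk \<phi> x"
    and mass: "real N / 8 \<le> (\<Sum>x\<in>{1..N}. \<phi> x)"
  shows "1 - 512 * exp (2 * l * t) / ((1 - \<rho>)\<^sup>2 * real N) \<le>
    tv_dist N (transition_prob N (1 / 2) \<alpha> \<beta> \<gamma> \<delta> t full) (pmf product_measure)"
proof -
  define p where "p = transition_prob N (1 / 2) \<alpha> \<beta> \<gamma> \<delta> t full"
  define f where "f \<eta> = (\<Sum>x\<in>{1..N}. deviation \<eta> {x})" for \<eta>
  define u where "u x = correlation full t {x}" for x
  define m where "m = (\<Sum>x\<in>{1..N}. u x)"
  have expect: "(\<Sum>\<xi>\<in>configs N. p \<xi> * deviation \<xi> A) = correlation full t A" for A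
    unfolding p_def correlation_def by (rule transition_prob_expectation[OF full_in_configs])
  have p: "0 \<le> p \<xi>" if "\<xi> \<in> configs N" for \<xi>
    unfolding p_def by (rule transition_prob_nonneg[OF full_in_configs that t])
  have p1: "(\<Sum>\<xi>\<in>configs N. p \<xi>) = 1"
    unfolding p_def by (rule sum_transition_prob[OF full_in_configs])
  have mean: "(\<Sum>\<xi>\<in>configs N. p \<xi> * f \<xi>) = m"
    unfolding f_def sum_distrib_left m_def u_def by (subst sum.swap) (simp add: expect)
  have "(1 - \<rho>) * exp (- l * t) * (real N / 8) \<le> (1 - \<rho>) * exp (- l * t) * (\<Sum>x\<in>{1..N}. \<phi> x)"
    using \<rho> by (intro mult_left_mono mass) auto
  also have "\<dots> \<le> m"
    unfolding m_def u_def sum_distrib_left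
    by (intro sum_mono correlation_full_ge t \<phi> sub) auto
  finally have m_ge: "(1 - \<rho>) * exp (- l * t) * (real N / 8) \<le> m" .
  moreover have low: "0 < (1 - \<rho>) * exp (- l * t) * (real N / 8)" using \<rho> N by simp
  ultimately have m: "0 < m" by linarith
  have square: "(\<Sum>\<xi>\<in>configs N. r \<xi> * (f \<xi>)\<^sup>2) =
      (\<Sum>x\<in>{1..N}. \<Sum>y\<in>{1..N}. \<Sum>\<xi>\<in>configs N. r \<xi> * (deviation \<xi> {x} * deviation \<xi> {y}))"
    for r :: "config \<Rightarrow> real"
  proof -
    have "(f \<xi>)\<^sup>2 = (\<Sum>x\<in>{1..N}. \<Sum>y\<in>{1..N}. deviation \<xi> {x} * deviation \<xi> {y})" for \<xi>
      unfolding f_def power2_eq_square by (rule sum_product)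
    thus ?thesis
      by (simp only: sum_distrib_left) (subst sum.swap, intro sum.cong refl, rule sum.swap)
  qed
  have "(\<Sum>\<xi>\<in>configs N. p \<xi> * (f \<xi>)\<^sup>2) \<le>
      (\<Sum>x\<in>{1..N}. \<Sum>y\<in>{1..N}. u x * u y + of_bool (x = y))"
    unfolding square
  proof (intro sum_mono)
    fix x y assume x: "x \<in> {1..N}" and y: "y \<in> {1..N}"
    show "(\<Sum>\<xi>\<in>configs N. p \<xi> * (deviation \<xi> {x} * deviation \<xi> {y})) \<le> u x * u y + of_bool (x = y)"
    proof (cases "x = y")
      case True
      have "(\<Sum>\<xi>\<in>configs N. p \<xi> * (deviation \<xi> {x} * deviation \<xi> {x})) \<le> (\<Sum>\<xi>\<in>configs N. p \<xi> * 1)"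
      proof (intro sum_mono mult_left_mono p)
        fix \<xi> assume "\<xi> \<in> configs N"
        hence "\<bar>deviation \<xi> {x}\<bar> \<le> 1" using x by (intro abs_deviation_le_1) auto
        thus "deviation \<xi> {x} * deviation \<xi> {x} \<le> 1"
          using abs_square_le_1[of "deviation \<xi> {x}"] by (simp add: power2_eq_square)
      qed
      thus ?thesis using True p1 by (simp add: add_increasing)
    next
      case False
      have "deviation \<xi> {x} * deviation \<xi> {y} = deviation \<xi> {x, y}" for \<xi>
        using False by (simp add: deviation_def)
      thus ?thesis using negative_correlation[OF t x y False] False by (simp add: expect u_def)
    qed
  qed
  also have "\<dots> = m\<^sup>2 + real N"
    by (simp add: sum.distrib m_def power2_eq_square sum_product)
  finally have var_p: "(\<Sum>\<xi>\<in>configs N. p \<xi> * (f \<xi>)\<^sup>2) \<le> m\<^sup>2 + real N" .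
  have "(\<Sum>\<xi>\<in>configs N. pmf product_measure \<xi> * (f \<xi>)\<^sup>2) =
      (\<Sum>x\<in>{1..N}. \<Sum>y\<in>{1..N}. of_bool (x = y) * site_variance)"
    unfolding square by (intro sum.cong refl) (auto simp: deviation_orthogonal)
  also have "\<dots> = real N * site_variance" by (simp flip: sum_distrib_right)
  also have "\<dots> \<le> real N" using \<rho> by (intro mult_left_le mult_le_one) auto
  finally have var_q: "(\<Sum>\<xi>\<in>configs N. pmf product_measure \<xi> * (f \<xi>)\<^sup>2) \<le> real N" .
  have "1 - 8 * real N / m\<^sup>2 \<le> tv_dist N p (pmf product_measure)"
    unfolding tv_dist_def
    by (rule total_variation_ge_second_moment[OF p p1 _ sum_pmf_product_measure mean m var_p var_q])
      simp_all
  moreover have "8 * real N / m\<^sup>2 \<le> 8 * real N / ((1 - \<rho>) * exp (- l * t) * (real N / 8))\<^sup>2"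
    using low m_ge m \<rho> N by (intro divide_left_mono power_mono mult_pos_pos zero_less_power) auto
  moreover have "8 * real N / ((1 - \<rho>) * exp (- l * t) * (real N / 8))\<^sup>2 =
      512 * exp (2 * l * t) / ((1 - \<rho>)\<^sup>2 * real N)"
  proof -
    have "(exp (- l * t))\<^sup>2 = 1 / exp (2 * l * t)"
      by (simp add: power2_eq_square exp_minus [symmetric] exp_add [symmetric] flip: inverse_eq_divide)
    hence "((1 - \<rho>) * exp (- l * t) * (real N / 8))\<^sup>2 =
        (1 - \<rho>)\<^sup>2 * (1 / exp (2 * l * t)) * ((real N)\<^sup>2 / 64)"
      by (simp add: power_mult_distrib power_divide)
    moreover have "1 - \<rho> \<noteq> 0" "real N \<noteq> 0" using N \<rho> by auto
    ultimately show ?thesis by (simp add: power2_eq_square)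
  qed
  ultimately show ?thesis by (simp add: p_def)
qed

end

section \<open>Cosine profiles for the walk killed at one end point\<close>

text \<open>The cosine is symmetric about \<open>1 / 2\<close>, hence compatible with reflection at site \<open>1\<close>; only
  the end point \<open>N\<close> contributes an error to the eigenvalue equation.\<close>

lemma killed_walk_cos:
  fixes \<theta> :: real and N :: nat
  defines "\<phi> \<equiv> \<lambda>x::nat. cos (\<theta> * (real x - 1 / 2))"
  assumes x: "x \<in> {1..N}"
  shows "killed_walk N 0 \<kappa> \<phi> x = - (1 - cos \<theta>) * \<phi> x
           + of_bool (x = N) * ((\<phi> N - \<phi> (N + 1)) / 2 - \<kappa> * \<phi> N)"
proof -
  have right: "\<phi> (x + 1) = cos \<theta> * \<phi> x - sin \<theta> * sin (\<theta> * (real x - 1 / 2))"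
    unfolding \<phi>_def cos_add [symmetric] by (simp add: algebra_simps)
  have left: "\<phi> (x - 1) = cos \<theta> * \<phi> x + sin \<theta> * sin (\<theta> * (real x - 1 / 2))"
    unfolding \<phi>_def cos_diff [symmetric] using x
    by (subst cos_minus [symmetric]) (simp add: algebra_simps of_nat_diff)
  have "\<phi> 0 = \<phi> 1" unfolding \<phi>_def by (subst cos_minus [symmetric]) simp
  hence "of_bool (1 < x) * (\<phi> (x - 1) - \<phi> x) / 2 = (\<phi> (x - 1) - \<phi> x) / 2"
    using x by (cases "x = 1") auto
  moreover have "of_bool (x < N) * (\<phi> (x + 1) - \<phi> x) / 2 =
      (\<phi> (x + 1) - \<phi> x) / 2 + of_bool (x = N) * ((\<phi> N - \<phi> (N + 1)) / 2)"
    using x by (cases "x = N") (auto simp: field_simps)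
  ultimately have "killed_walk N 0 \<kappa> \<phi> x =
      ((\<phi> (x + 1) - \<phi> x) / 2 + of_bool (x = N) * ((\<phi> N - \<phi> (N + 1)) / 2))
        + (\<phi> (x - 1) - \<phi> x) / 2 - (\<kappa> * of_bool (x = N)) * \<phi> x"
    unfolding killed_walk_explicit[OF x] by (simp only: mult_zero_left add_0_left)
  also have "(\<kappa> * of_bool (x = N)) * \<phi> x = of_bool (x = N) * (\<kappa> * \<phi> N)" by simp
  finally show ?thesis
    unfolding left right by (simp add: field_simps)
qed

text \<open>A frequency below the critical value \<open>\<pi> / (2 * N)\<close> keeps the profile away from \<open>0\<close> at the
  killed end point. There the killing outweighs the missing jump to the right once \<open>N\<close> is large,
  because the neighbouring values of the profile differ by \<open>O(1 / N)\<close> only.\<close>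

lemma relaxing_profile_right:
  fixes \<kappa> s :: real
  assumes \<kappa>: "0 < \<kappa>" and s: "0 < s" "s < 1"
  shows "\<forall>\<^sub>F N in sequentially. \<exists>\<phi>. \<forall>x\<in>{1..N}. cos (s * pi / 2) \<le> \<phi> x \<and> \<phi> x \<le> 1 \<and>
           killed_walk N 0 \<kappa> \<phi> x \<le> - (1 - cos (s * pi / (2 * real N))) * \<phi> x"
proof -
  define c where "c = cos (s * pi / 2)"
  have c: "0 < c" unfolding c_def using s by (intro cos_gt_zero) auto
  have "(\<lambda>N. s * pi / (2 * real N) / 2) \<longlonglongrightarrow> 0" by real_asymp
  hence "\<forall>\<^sub>F N in sequentially. s * pi / (2 * real N) / 2 < \<kappa> * c"
    using \<kappa> c by (intro order_tendstoD) auto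
  thus ?thesis
    using eventually_ge_at_top[of 1]
  proof eventually_elim
    case (elim N)
    define \<theta> where "\<theta> = s * pi / (2 * real N)"
    define \<phi> where "\<phi> x = cos (\<theta> * (real x - 1 / 2))" for x :: nat
    have \<theta>: "0 < \<theta>" "\<theta> * real N = s * pi / 2"
      using s elim by (auto simp: \<theta>_def)
    have ge: "c \<le> \<phi> x" if "x \<in> {1..N}" for x
      unfolding c_def \<phi>_def \<theta>(2) [symmetric]
    proof (rule cos_monotone_0_pi_le)
      show "0 \<le> \<theta> * (real x - 1 / 2)" using \<theta> that by simp
      show "\<theta> * (real x - 1 / 2) \<le> \<theta> * real N" using \<theta> that by (intro mult_left_mono) auto
      have "s * pi \<le> 1 * pi" using s by (intro mult_right_mono) auto
      thus "\<theta> * real N \<le> pi" unfolding \<theta>(2) using pi_gt_zero by linarith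
    qed
    have "\<phi> N - \<phi> (N + 1) \<le> \<theta>"
    proof -
      have "\<phi> N - \<phi> (N + 1) = 2 * sin (\<theta> * real N) * sin (\<theta> / 2)"
        unfolding \<phi>_def by (subst cos_diff_cos) (simp add: algebra_simps add_divide_distrib)
      also have "\<dots> \<le> 2 * \<bar>sin (\<theta> * real N)\<bar> * \<bar>sin (\<theta> / 2)\<bar>"
        using abs_ge_self[of "sin (\<theta> * real N) * sin (\<theta> / 2)"] by (simp add: abs_mult)
      also have "\<dots> \<le> 2 * 1 * (\<theta> / 2)"
        using \<theta>(1) abs_sin_x_le_abs_x[of "\<theta> / 2"] by (intro mult_mono) auto
      finally show ?thesis by simp
    qed
    moreover have "\<theta> / 2 < \<kappa> * c" using elim by (simp add: \<theta>_def)
    moreover have "\<kappa> * c \<le> \<kappa> * \<phi> N" using \<kappa> ge[of N] elim by simp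
    ultimately have "\<phi> N - \<phi> (N + 1) \<le> 2 * (\<kappa> * \<phi> N)" by linarith
    hence "(\<phi> N - \<phi> (N + 1)) / 2 - \<kappa> * \<phi> N \<le> 0" by simp
    hence "killed_walk N 0 \<kappa> \<phi> x \<le> - (1 - cos \<theta>) * \<phi> x" if "x \<in> {1..N}" for x
      using killed_walk_cos[OF that, of \<kappa> \<theta>] by (auto simp: \<phi>_def [abs_def])
    thus ?case
      using ge by (intro exI[of _ \<phi>]) (auto simp: \<phi>_def c_def \<theta>_def)
  qed
qed

lemma relaxing_profile:
  assumes "(\<kappa>\<^sub>l = 0 \<and> 0 < \<kappa>\<^sub>r) \<or> (0 < \<kappa>\<^sub>l \<and> \<kappa>\<^sub>r = 0)" and s: "0 < s" "s < 1"
  shows "\<forall>\<^sub>F N in sequentially. \<exists>\<phi>. \<forall>x\<in>{1..N}. cos (s * pi / 2) \<le> \<phi> x \<and> \<phi> x \<le> 1 \<and>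
           killed_walk N \<kappa>\<^sub>l \<kappa>\<^sub>r \<phi> x \<le> - (1 - cos (s * pi / (2 * real N))) * \<phi> x"
  using assms(1)
proof
  assume "\<kappa>\<^sub>l = 0 \<and> 0 < \<kappa>\<^sub>r"
  thus ?thesis using relaxing_profile_right[OF _ s, of \<kappa>\<^sub>r] by simp
next
  assume \<kappa>: "0 < \<kappa>\<^sub>l \<and> \<kappa>\<^sub>r = 0"
  hence "\<forall>\<^sub>F N in sequentially. \<exists>\<phi>. \<forall>x\<in>{1..N}. cos (s * pi / 2) \<le> \<phi> x \<and> \<phi> x \<le> 1 \<and>
      killed_walk N 0 \<kappa>\<^sub>l \<phi> x \<le> - (1 - cos (s * pi / (2 * real N))) * \<phi> x"
    by (intro relaxing_profile_right s) auto
  thus ?thesis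
  proof eventually_elim
    case (elim N)
    then obtain \<phi> where \<phi>: "\<And>x. x \<in> {1..N} \<Longrightarrow> cos (s * pi / 2) \<le> \<phi> x \<and> \<phi> x \<le> 1 \<and>
      killed_walk N 0 \<kappa>\<^sub>l \<phi> x \<le> - (1 - cos (s * pi / (2 * real N))) * \<phi> x" by blast
    show ?case
    proof (intro exI[of _ "\<lambda>x. \<phi> (N + 1 - x)"] ballI)
      fix x assume x: "x \<in> {1..N}"
      hence "N + 1 - x \<in> {1..N}" by auto
      from \<phi>[OF this] show "cos (s * pi / 2) \<le> \<phi> (N + 1 - x) \<and> \<phi> (N + 1 - x) \<le> 1 \<and>
          killed_walk N \<kappa>\<^sub>l \<kappa>\<^sub>r (\<lambda>x. \<phi> (N + 1 - x)) x
            \<le> - (1 - cos (s * pi / (2 * real N))) * \<phi> (N + 1 - x)"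
        using \<kappa> killed_walk_reflect[OF x, of \<kappa>\<^sub>l \<kappa>\<^sub>r \<phi>] by simp
    qed
  qed
qed

text \<open>The frequency \<open>\<pi> / (2 * N - 1)\<close> puts the zero of the cosine at the killed end point, so that the
  profile is a subsolution for every killing rate.\<close>

lemma slow_profile_right:
  fixes N :: nat and \<kappa> :: real
  assumes N: "2 \<le> N"
  shows "\<exists>\<phi>. (\<forall>x\<in>{1..N}. 0 \<le> \<phi> x \<and> \<phi> x \<le> 1 \<and>
           - (1 - cos (pi / (2 * real N - 1))) * \<phi> x \<le> killed_walk N 0 \<kappa> \<phi> x) \<and>
           real N / 8 \<le> (\<Sum>x\<in>{1..N}. \<phi> x)"
proof -
  define \<theta> where "\<theta> = pi / (2 * real N - 1)"
  define \<phi> where "\<phi> x = cos (\<theta> * (real x - 1 / 2))" for x :: nat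
  have N1: "0 < 2 * real N - 1" using N by simp
  have \<theta>: "0 < \<theta>" "\<theta> \<le> pi" "\<theta> * (real N - 1 / 2) = pi / 2"
    using N by (auto simp: \<theta>_def field_simps)
  have arg: "0 \<le> \<theta> * (real x - 1 / 2)" "\<theta> * (real x - 1 / 2) \<le> pi / 2" if "x \<in> {1..N}" for x
  proof -
    show "0 \<le> \<theta> * (real x - 1 / 2)" using \<theta> that by simp
    have "\<theta> * (real x - 1 / 2) \<le> \<theta> * (real N - 1 / 2)"
      using \<theta> that by (intro mult_left_mono) auto
    thus "\<theta> * (real x - 1 / 2) \<le> pi / 2" by (simp add: \<theta>(3))
  qed
  have nonneg: "0 \<le> \<phi> x" if "x \<in> {1..N}" for x
    unfolding \<phi>_def using arg[OF that] by (intro cos_ge_zero) auto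
  have zero: "\<phi> N = 0" by (simp only: \<phi>_def \<theta>(3) cos_pi_half)
  have "\<theta> * (real (N + 1) - 1 / 2) = pi / 2 + \<theta>" using \<theta>(3) by (simp add: algebra_simps)
  hence "\<phi> (N + 1) = - sin \<theta>" by (simp only: \<phi>_def cos_add) simp
  hence "\<phi> (N + 1) \<le> 0" using sin_ge_zero[of \<theta>] \<theta> by simp
  hence sub: "- (1 - cos \<theta>) * \<phi> x \<le> killed_walk N 0 \<kappa> \<phi> x" if "x \<in> {1..N}" for x
    using killed_walk_cos[OF that, of \<kappa> \<theta>] zero by (auto simp: \<phi>_def [abs_def])
  \<comment> \<open>On the half of the segment away from the killed end point the argument is at most \<open>\<pi> / 3\<close>.\<close>
  have half: "1 / 2 \<le> \<phi> x" if "x \<in> {1..N div 2}" for x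
  proof -
    have "3 * (real x - 1 / 2) \<le> 2 * real N - 1" using that N by auto
    hence "\<theta> * (real x - 1 / 2) \<le> \<theta> * ((2 * real N - 1) / 3)"
      using \<theta> by (intro mult_left_mono) auto
    also have "\<dots> = pi / 3" using N1 by (simp add: \<theta>_def)
    finally have "cos (pi / 3) \<le> cos (\<theta> * (real x - 1 / 2))"
      using arg(1)[of x] that pi_gt_zero by (intro cos_monotone_0_pi_le) auto
    thus ?thesis by (simp add: \<phi>_def cos_60)
  qed
  have "real N / 8 \<le> (\<Sum>x\<in>{1..N div 2}. 1 / 2)" using N by simp
  also have "\<dots> \<le> (\<Sum>x\<in>{1..N div 2}. \<phi> x)" by (intro sum_mono half)
  also have "\<dots> \<le> (\<Sum>x\<in>{1..N}. \<phi> x)" using nonneg by (intro sum_mono2) auto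
  finally show ?thesis
    using nonneg sub by (intro exI[of _ \<phi>]) (auto simp: \<phi>_def \<theta>_def)
qed

lemma slow_profile:
  assumes N: "2 \<le> N" and "\<kappa>\<^sub>l = 0 \<or> \<kappa>\<^sub>r = 0"
  shows "\<exists>\<phi>. (\<forall>x\<in>{1..N}. 0 \<le> \<phi> x \<and> \<phi> x \<le> 1 \<and>
           - (1 - cos (pi / (2 * real N - 1))) * \<phi> x \<le> killed_walk N \<kappa>\<^sub>l \<kappa>\<^sub>r \<phi> x) \<and>
           real N / 8 \<le> (\<Sum>x\<in>{1..N}. \<phi> x)"
  using assms(2)
proof
  assume "\<kappa>\<^sub>l = 0"
  thus ?thesis using slow_profile_right[OF N, of \<kappa>\<^sub>r] by simp
next
  assume \<kappa>: "\<kappa>\<^sub>r = 0"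
  obtain \<phi> where \<phi>: "\<And>x. x \<in> {1..N} \<Longrightarrow> 0 \<le> \<phi> x \<and> \<phi> x \<le> 1 \<and>
      - (1 - cos (pi / (2 * real N - 1))) * \<phi> x \<le> killed_walk N 0 \<kappa>\<^sub>l \<phi> x"
    "real N / 8 \<le> (\<Sum>x\<in>{1..N}. \<phi> x)"
    using slow_profile_right[OF N, of \<kappa>\<^sub>l] by blast
  have "- (1 - cos (pi / (2 * real N - 1))) * \<phi> (N + 1 - x)
        \<le> killed_walk N \<kappa>\<^sub>l \<kappa>\<^sub>r (\<lambda>x. \<phi> (N + 1 - x)) x \<and> 0 \<le> \<phi> (N + 1 - x) \<and> \<phi> (N + 1 - x) \<le> 1"
    if x: "x \<in> {1..N}" for x
  proof -
    have "N + 1 - x \<in> {1..N}" using x by auto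
    from \<phi>(1)[OF this] show ?thesis
      using \<kappa> killed_walk_reflect[OF x, of \<kappa>\<^sub>l \<kappa>\<^sub>r \<phi>] by simp
  qed
  moreover have "(\<Sum>x\<in>{1..N}. \<phi> (N + 1 - x)) = (\<Sum>x\<in>{1..N}. \<phi> x)"
    by (rule sum.reindex_bij_witness[of _ "\<lambda>x. N + 1 - x" "\<lambda>x. N + 1 - x"]) auto
  ultimately show ?thesis
    using \<phi>(2) by (intro exI[of _ "\<lambda>x. \<phi> (N + 1 - x)"]) simp
qed

section \<open>Asymptotics of the mixing time\<close>

lemma Max_tv_less_iff:
  "Max ((\<lambda>\<eta>. tv_dist N (P \<eta>) Q) ` configs N) < \<epsilon> \<longleftrightarrow> (\<forall>\<eta>\<in>configs N. tv_dist N (P \<eta>) Q < \<epsilon>)"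
proof -
  have "configs N \<noteq> {}" by (auto simp: configs_def PiE_eq_empty_iff)
  thus ?thesis by (subst Max_less_iff) auto
qed

lemma mixing_time_le:
  assumes "0 \<le> t" and "\<And>\<eta>. \<eta> \<in> configs N \<Longrightarrow>
    tv_dist N (transition_prob N p \<alpha> \<beta> \<gamma> \<delta> t \<eta>) (pmf (stationary_dist N p \<alpha> \<beta> \<gamma> \<delta>)) < \<epsilon>"
  shows "mixing_time N p \<alpha> \<beta> \<gamma> \<delta> \<epsilon> \<le> t"
  unfolding mixing_time_def Max_tv_less_iff
  using assms by (intro cInf_lower bdd_belowI[of _ 0]) auto

lemma mixing_time_ge:
  assumes "\<And>\<eta>. \<eta> \<in> configs N \<Longrightarrow>
    tv_dist N (transition_prob N p \<alpha> \<beta> \<gamma> \<delta> t' \<eta>) (pmf (stationary_dist N p \<alpha> \<beta> \<gamma> \<delta>)) < \<epsilon>"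
    and "0 \<le> t'" and \<eta>: "\<eta> \<in> configs N"
    and far: "\<And>s. 0 \<le> s \<Longrightarrow> s \<le> t \<Longrightarrow>
      \<epsilon> \<le> tv_dist N (transition_prob N p \<alpha> \<beta> \<gamma> \<delta> s \<eta>) (pmf (stationary_dist N p \<alpha> \<beta> \<gamma> \<delta>))"
  shows "t \<le> mixing_time N p \<alpha> \<beta> \<gamma> \<delta> \<epsilon>"
  unfolding mixing_time_def Max_tv_less_iff
proof (rule cInf_greatest, goal_cases)
  case 1
  thus ?case using assms(1,2) by blast
next
  case (2 s)
  thus ?case using far[of s] \<eta> by fastforce
qed

lemma power_decay:
  fixes a :: "nat \<Rightarrow> real"
  assumes "a \<longlonglongrightarrow> A" "1 < A"
  shows "(\<lambda>N. real N * exp (- a N * ln (real N))) \<longlonglongrightarrow> 0"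
proof (rule Lim_null_comparison)
  define r where "r = (1 + A) / 2"
  have r: "1 < r" "r < A" using assms(2) by (auto simp: r_def)
  show "(\<lambda>N. real N powr (1 - r)) \<longlonglongrightarrow> 0" using r by real_asymp
  show "\<forall>\<^sub>F N in sequentially. norm (real N * exp (- a N * ln (real N))) \<le> real N powr (1 - r)"
    using order_tendstoD(1)[OF assms(1) r(2)] eventually_ge_at_top[of 1]
  proof eventually_elim
    case (elim N)
    have "r * ln (real N) \<le> a N * ln (real N)" using elim by (intro mult_right_mono) auto
    hence "real N * exp (- a N * ln (real N)) \<le> real N * exp (- r * ln (real N))"
      by (intro mult_left_mono) auto
    also have "\<dots> = real N powr (1 - r)"
      using elim by (simp add: powr_def exp_add [symmetric] algebra_simps exp_diff exp_minus field_simps)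
    finally show ?case by simp
  qed
qed

lemma power_growth:
  fixes a :: "nat \<Rightarrow> real"
  assumes "a \<longlonglongrightarrow> A" "A < 1"
  shows "(\<lambda>N. exp (a N * ln (real N)) / real N) \<longlonglongrightarrow> 0"
proof (rule Lim_null_comparison)
  define r where "r = (1 + A) / 2"
  have r: "r < 1" "A < r" using assms(2) by (auto simp: r_def)
  show "(\<lambda>N. real N powr (r - 1)) \<longlonglongrightarrow> 0" using r by real_asymp
  show "\<forall>\<^sub>F N in sequentially. norm (exp (a N * ln (real N)) / real N) \<le> real N powr (r - 1)"
    using order_tendstoD(2)[OF assms(1) r(2)] eventually_ge_at_top[of 1]
  proof eventually_elim
    case (elim N)
    have "a N * ln (real N) \<le> r * ln (real N)" using elim by (intro mult_right_mono) auto
    hence "exp (a N * ln (real N)) / real N \<le> exp (r * ln (real N)) / real N"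
      by (simp add: divide_right_mono)
    also have "\<dots> = real N powr (r - 1)"
      using elim by (simp add: powr_def exp_diff algebra_simps)
    finally show ?case by simp
  qed
qed

text \<open>A closed end has both rates \<open>0\<close> and satisfies the density equation for every \<open>\<rho>\<close>, so the
  density of the open end serves for both.\<close>

locale one_sided_reservoir =
  fixes \<alpha> \<beta> \<gamma> \<delta> \<rho> :: real
  assumes rates: "0 \<le> \<alpha>" "0 \<le> \<beta>" "0 \<le> \<gamma>" "0 \<le> \<delta>"
    and density: "\<alpha> = \<rho> * (\<alpha> + \<gamma>)" "\<delta> = \<rho> * (\<beta> + \<delta>)"
    and \<rho>: "0 < \<rho>" "\<rho> < 1"
    and one_sided: "(\<alpha> + \<gamma> = 0 \<and> 0 < \<beta> + \<delta>) \<or> (0 < \<alpha> + \<gamma> \<and> \<beta> + \<delta> = 0)"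
begin

lemma reservoirs: "1 \<le> N \<Longrightarrow> equal_reservoirs N \<alpha> \<beta> \<gamma> \<delta> \<rho>"
  using rates density \<rho> by unfold_locales

definition equilibrium :: "nat \<Rightarrow> config \<Rightarrow> real" where
  "equilibrium N = pmf (stationary_dist N (1 / 2) \<alpha> \<beta> \<gamma> \<delta>)"

definition distance :: "nat \<Rightarrow> real \<Rightarrow> config \<Rightarrow> real" where
  "distance N t \<eta> = tv_dist N (transition_prob N (1 / 2) \<alpha> \<beta> \<gamma> \<delta> t \<eta>) (equilibrium N)"

lemma decay_rate_pos:
  assumes "0 < s" "s < 1" "1 \<le> N"
  shows "0 < 1 - cos (s * pi / (2 * real N))"
proof -
  have "s * pi / (2 * real N) \<le> 1 * pi / 1"
    using assms by (intro frac_le mult_right_mono) auto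
  moreover have "0 < s * pi / (2 * real N)" using assms by simp
  ultimately have "cos (s * pi / (2 * real N)) < cos 0"
    by (intro cos_monotone_0_pi) simp_all
  thus ?thesis by simp
qed

lemma eventually_mixed:
  fixes s :: real
  assumes s: "0 < s" "s < 1"
  shows "\<forall>\<^sub>F N in sequentially.
    stationary_dist N (1 / 2) \<alpha> \<beta> \<gamma> \<delta> = equal_reservoirs.product_measure N \<rho> \<and>
    (\<forall>t\<ge>0. \<forall>\<eta>\<in>configs N. distance N t \<eta> \<le> 1 / 2 * sqrt (exp (
       real N * exp (- 2 * (1 - cos (s * pi / (2 * real N))) * t)
         / ((cos (s * pi / 2))\<^sup>2 * (\<rho> * (1 - \<rho>)))) - 1))"
  using relaxing_profile[OF one_sided s] eventually_ge_at_top[of 1]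
proof eventually_elim
  case (elim N)
  interpret equal_reservoirs N \<alpha> \<beta> \<gamma> \<delta> \<rho> using elim(2) by (rule reservoirs)
  have c: "0 < cos (s * pi / 2)" using s by (intro cos_gt_zero) auto
  obtain \<phi> where \<phi>: "\<And>x. x \<in> {1..N} \<Longrightarrow> cos (s * pi / 2) \<le> \<phi> x \<and> \<phi> x \<le> 1"
    "\<And>x. x \<in> {1..N} \<Longrightarrow> walk \<phi> x \<le> - (1 - cos (s * pi / (2 * real N))) * \<phi> x"
    using elim(1) by blast
  have "stationary_dist N (1 / 2) \<alpha> \<beta> \<gamma> \<delta> = product_measure"
    using c \<phi> decay_rate_pos[OF s elim(2)] by (rule stationary_dist_eq)
  moreover from this have "distance N t \<eta> \<le> 1 / 2 * sqrt (exp (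
       real N * exp (- 2 * (1 - cos (s * pi / (2 * real N))) * t)
         / ((cos (s * pi / 2))\<^sup>2 * (\<rho> * (1 - \<rho>)))) - 1)" if "0 \<le> t" "\<eta> \<in> configs N" for t \<eta>
    unfolding distance_def equilibrium_def using tv_dist_upper_bound[OF that(2,1) c \<phi>] by simp
  ultimately show ?case by blast
qed

text \<open>With \<open>\<theta> = s * pi / (2 * N)\<close> the exponent \<open>2 * (1 - cos \<theta>) * t\<close> at \<open>t = b * N\<^sup>2 * ln N\<close> is
  asymptotically \<open>(s\<^sup>2 * pi\<^sup>2 * b / 4) * ln N\<close>. It beats \<open>ln N\<close> when \<open>s\<close> is close to \<open>1\<close>.\<close>

lemma mixed_after:
  fixes b :: real
  assumes b: "4 / pi\<^sup>2 < b" and \<epsilon>: "0 < \<epsilon>"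
  shows "\<forall>\<^sub>F N in sequentially. \<forall>\<eta>\<in>configs N. distance N (b * (real N ^ 2 * ln (real N))) \<eta> < \<epsilon>"
proof -
  define r where "r = 4 / (pi\<^sup>2 * b)"
  have pos: "0 < b" using b by (rule le_less_trans [rotated]) simp
  have r: "0 < r" "r < 1" using b pos by (auto simp: r_def field_simps)
  \<comment> \<open>Any \<open>s < 1\<close> with \<open>s\<^sup>2 > r\<close> would do.\<close>
  define s where "s = sqrt ((1 + r) / 2)"
  have s: "0 < s" "s < 1" "r < s\<^sup>2" using r by (auto simp: s_def)
  define a where "a N = 2 * (1 - cos (s * pi / (2 * real N))) * b * real N ^ 2" for N :: nat
  define C where "C = (cos (s * pi / 2))\<^sup>2 * (\<rho> * (1 - \<rho>))"
  have "0 < cos (s * pi / 2)" using s by (intro cos_gt_zero) auto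
  hence C: "C \<noteq> 0" using \<rho> by (simp add: C_def)
  have "a \<longlonglongrightarrow> s\<^sup>2 * pi\<^sup>2 * b / 4"
    unfolding a_def by (real_asymp simp: field_simps power2_eq_square)
  moreover have "1 < s\<^sup>2 * pi\<^sup>2 * b / 4"
    using s(3) pos by (simp add: r_def field_simps)
  ultimately have "(\<lambda>N. real N * exp (- a N * ln (real N))) \<longlonglongrightarrow> 0" by (rule power_decay)
  hence "(\<lambda>N. 1 / 2 * sqrt (exp (real N * exp (- a N * ln (real N)) / C) - 1)) \<longlonglongrightarrow>
      1 / 2 * sqrt (exp (0 / C) - 1)"
    by (intro tendsto_intros C)
  hence "\<forall>\<^sub>F N in sequentially. 1 / 2 * sqrt (exp (real N * exp (- a N * ln (real N)) / C) - 1) < \<epsilon>"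
    using \<epsilon> by (intro order_tendstoD) auto
  thus ?thesis
    using eventually_mixed[OF s(1,2)] eventually_ge_at_top[of 1]
  proof eventually_elim
    case (elim N)
    define t where "t = b * (real N ^ 2 * ln (real N))"
    have "0 \<le> t" using elim(3) pos by (simp add: t_def)
    moreover have "- 2 * (1 - cos (s * pi / (2 * real N))) * t = - a N * ln (real N)"
      by (simp add: a_def t_def algebra_simps)
    ultimately have "\<forall>\<eta>\<in>configs N. distance N t \<eta> \<le>
        1 / 2 * sqrt (exp (real N * exp (- a N * ln (real N)) / C) - 1)"
      using elim(2) unfolding C_def by metis
    thus ?case using elim(1) unfolding t_def by force
  qed
qed

lemma not_mixed_before:
  fixes b :: real
  assumes b: "0 < b" "b < 4 / pi\<^sup>2" and \<epsilon>: "\<epsilon> < 1"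
  shows "\<forall>\<^sub>F N in sequentially. \<exists>\<eta>\<in>configs N. \<forall>t\<ge>0. t \<le> b * (real N ^ 2 * ln (real N)) \<longrightarrow>
    \<epsilon> \<le> distance N t \<eta>"
proof -
  define a where "a N = 2 * (1 - cos (pi / (2 * real N - 1))) * b * real N ^ 2" for N :: nat
  define C where "C = 512 / (1 - \<rho>)\<^sup>2"
  have "a \<longlonglongrightarrow> pi\<^sup>2 * b / 4"
    unfolding a_def by (real_asymp simp: field_simps power2_eq_square)
  moreover have "pi\<^sup>2 * b / 4 < 1" using b by (simp add: field_simps)
  ultimately have "(\<lambda>N. exp (a N * ln (real N)) / real N) \<longlonglongrightarrow> 0" by (rule power_growth)
  hence "(\<lambda>N. 1 - C * (exp (a N * ln (real N)) / real N)) \<longlonglongrightarrow> 1 - C * 0"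
    by (intro tendsto_intros)
  hence "\<forall>\<^sub>F N in sequentially. \<epsilon> < 1 - C * (exp (a N * ln (real N)) / real N)"
    using \<epsilon> by (intro order_tendstoD) auto
  moreover have "\<forall>\<^sub>F N in sequentially.
      stationary_dist N (1 / 2) \<alpha> \<beta> \<gamma> \<delta> = equal_reservoirs.product_measure N \<rho>"
    using eventually_mixed[of "1 / 2"] by (auto elim: eventually_mono)
  ultimately show ?thesis
    using eventually_ge_at_top[of 2]
  proof eventually_elim
    case (elim N)
    interpret equal_reservoirs N \<alpha> \<beta> \<gamma> \<delta> \<rho> using elim(3) by (intro reservoirs) simp
    define l where "l = 1 - cos (pi / (2 * real N - 1))"
    have l: "0 \<le> l" by (simp add: l_def)
    obtain \<phi> where \<phi>: "\<And>x. x \<in> {1..N} \<Longrightarrow> 0 \<le> \<phi> x \<and> \<phi> x \<le> 1"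
      "\<And>x. x \<in> {1..N} \<Longrightarrow> - l * \<phi> x \<le> walk \<phi> x"
      "real N / 8 \<le> (\<Sum>x\<in>{1..N}. \<phi> x)"
      using slow_profile[OF elim(3), of "\<alpha> + \<gamma>" "\<beta> + \<delta>"] one_sided unfolding l_def by blast
    have "\<epsilon> \<le> distance N t full" if t: "0 \<le> t" "t \<le> b * (real N ^ 2 * ln (real N))" for t
    proof -
      have "2 * l * t \<le> 2 * l * (b * (real N ^ 2 * ln (real N)))"
        using l t by (intro mult_left_mono) auto
      also have "\<dots> = a N * ln (real N)" by (simp add: a_def l_def algebra_simps)
      finally have "C * (exp (2 * l * t) / real N) \<le> C * (exp (a N * ln (real N)) / real N)"
        using \<rho> by (intro mult_left_mono divide_right_mono) (auto simp: C_def)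
      moreover have "C * (exp (2 * l * t) / real N) = 512 * exp (2 * l * t) / ((1 - \<rho>)\<^sup>2 * real N)"
        by (simp add: C_def)
      ultimately show ?thesis
        using tv_dist_lower_bound[OF t(1) \<phi>] elim(1)
        unfolding distance_def equilibrium_def elim(2) by linarith
    qed
    thus ?case using full_in_configs by blast
  qed
qed

theorem mixing_time_limit:
  assumes \<epsilon>: "0 < \<epsilon>" "\<epsilon> < 1"
  shows "(\<lambda>N. mixing_time N (1 / 2) \<alpha> \<beta> \<gamma> \<delta> \<epsilon> / (real N ^ 2 * ln (real N))) \<longlonglongrightarrow> 4 / pi\<^sup>2"
proof (rule order_tendstoI)
  fix b :: real assume b: "4 / pi\<^sup>2 < b"
  then obtain b' where b': "4 / pi\<^sup>2 < b'" "b' < b" using dense by blast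
  have pos: "0 \<le> b'" using b'(1) by (meson less_imp_le order_trans zero_le_divide_iff zero_le_numeral zero_le_power2)
  show "\<forall>\<^sub>F N in sequentially. mixing_time N (1 / 2) \<alpha> \<beta> \<gamma> \<delta> \<epsilon> / (real N ^ 2 * ln (real N)) < b"
    using mixed_after[OF b'(1) \<epsilon>(1)] eventually_ge_at_top[of 2]
  proof eventually_elim
    case (elim N)
    have scale: "0 < real N ^ 2 * ln (real N)" using elim(2) by simp
    have "mixing_time N (1 / 2) \<alpha> \<beta> \<gamma> \<delta> \<epsilon> \<le> b' * (real N ^ 2 * ln (real N))"
      using elim(1) scale pos unfolding distance_def equilibrium_def
      by (intro mixing_time_le) auto
    hence "mixing_time N (1 / 2) \<alpha> \<beta> \<gamma> \<delta> \<epsilon> / (real N ^ 2 * ln (real N)) \<le> b'"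
      using scale by (simp add: pos_divide_le_eq)
    thus ?case using b'(2) by linarith
  qed
next
  fix b :: real assume "b < 4 / pi\<^sup>2"
  hence "max b 0 < 4 / pi\<^sup>2" by simp
  then obtain b' where b': "max b 0 < b'" "b' < 4 / pi\<^sup>2" using dense by blast
  obtain B where B: "4 / pi\<^sup>2 < B" using gt_ex by blast
  have pos: "0 < b'" "0 \<le> B" using b' B by simp_all
  show "\<forall>\<^sub>F N in sequentially. b < mixing_time N (1 / 2) \<alpha> \<beta> \<gamma> \<delta> \<epsilon> / (real N ^ 2 * ln (real N))"
    using not_mixed_before[OF pos(1) b'(2) \<epsilon>(2)] mixed_after[OF B \<epsilon>(1)] eventually_ge_at_top[of 2]
  proof eventually_elim
    case (elim N)
    have scale: "0 < real N ^ 2 * ln (real N)" using elim(3) by simp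
    obtain \<eta> where \<eta>: "\<eta> \<in> configs N"
      "\<And>t. 0 \<le> t \<Longrightarrow> t \<le> b' * (real N ^ 2 * ln (real N)) \<Longrightarrow> \<epsilon> \<le> distance N t \<eta>"
      using elim(1) b'(1) by auto
    have "b' * (real N ^ 2 * ln (real N)) \<le> mixing_time N (1 / 2) \<alpha> \<beta> \<gamma> \<delta> \<epsilon>"
      using elim(2) \<eta> scale pos(2) unfolding distance_def equilibrium_def
      by (intro mixing_time_ge[where t' = "B * (real N ^ 2 * ln (real N))"]) auto
    hence "b' \<le> mixing_time N (1 / 2) \<alpha> \<beta> \<gamma> \<delta> \<epsilon> / (real N ^ 2 * ln (real N))"
      using scale by (simp add: pos_le_divide_eq)
    thus ?case using b'(1) by simp
  qed
qed

end

theorem theorem1p2: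
  fixes \<alpha> \<beta> \<gamma> \<delta> \<epsilon> :: real
  assumes "\<alpha> \<ge> 0" and "\<beta> \<ge> 0" and "\<gamma> \<ge> 0" and "\<delta> \<ge> 0"
    and "(max \<alpha> \<gamma> = 0 \<and> min \<beta> \<delta> > 0) \<or> (min \<alpha> \<gamma> > 0 \<and> max \<beta> \<delta> = 0)"
    and "0 < \<epsilon>" and "\<epsilon> < 1"
  shows "(\<lambda>N. mixing_time N (1 / 2) \<alpha> \<beta> \<gamma> \<delta> \<epsilon> / (real N ^ 2 * ln (real N)))
           \<longlonglongrightarrow> 4 / pi ^ 2"
proof -
  have "\<exists>\<rho>. one_sided_reservoir \<alpha> \<beta> \<gamma> \<delta> \<rho>"
    using assms(5)
  proof
    assume "max \<alpha> \<gamma> = 0 \<and> min \<beta> \<delta> > 0"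
    hence "\<alpha> = 0" "\<gamma> = 0" "0 < \<beta>" "0 < \<delta>" using assms(1,3) by auto
    thus ?thesis by (intro exI[of _ "\<delta> / (\<beta> + \<delta>)"], unfold_locales) (auto simp: field_simps)
  next
    assume "min \<alpha> \<gamma> > 0 \<and> max \<beta> \<delta> = 0"
    hence "\<beta> = 0" "\<delta> = 0" "0 < \<alpha>" "0 < \<gamma>" using assms(2,4) by auto
    thus ?thesis by (intro exI[of _ "\<alpha> / (\<alpha> + \<gamma>)"], unfold_locales) (auto simp: field_simps)
  qed
  thus ?thesis using one_sided_reservoir.mixing_time_limit assms(6,7) by blast
qed

end
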